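(* Let $K\in\mathcal{U}C_{b}^{3}(\mathbb{R}^{d},\mathbb{R}^{d\times d})$, let $N\in\mathbb{N}$ and let $\{\alpha_{j}^{N}\}_{j=1,\dots,N}$ be real weights. Consider the system of interacting curves \[ \frac{\partial}{\partial t}\gamma_{t}^{i,N}(\sigma)=\sum_{j=1}^{N}\alpha_{j}^{N}\int_{0}^{1}K\left(\gamma_{t}^{i,N}(\sigma)-\gamma_{t}^{j,N}(\sigma')\right)\frac{\partial}{\partial\sigma'}\gamma_{t}^{j,N}(\sigma')\,d\sigma',\qquad i=1,\dots,N, \tag{E1} \] with $\gamma_{0}^{i,N}$ given, and to a family of curves associate the current $\xi_{t}:C_{b}(\mathbb{R}^{d};\mathbb{R}^{d})\to\mathbb{R}$, \[ \xi_{t}(\theta):=\sum_{j=1}^{N}\alpha_{j}^{N}\int_{0}^{1}\left\langle\theta\left(\gamma_{t}^{j,N}(\sigma)\right),\frac{\partial}{\partial\sigma}\gamma_{t}^{j,N}(\sigma)\right\rangle d\sigma. \tag{E2} \] Consider also the flow equation for currents \[ \xi_{t}=\varphi_{\sharp}^{t,K\ast\xi}\xi_{0},\qquad t\in[0,T]. \tag{E3} \] If $\{\gamma_{t}^{i,N}(\sigma),\ i=1,\dots,N,\ t\in[0,T],\ \sigma\in[0,1]\}$ is a family of $C^{1}([0,T]\times[0,1];\mathbb{R}^{d})$ functions satisfying (E1), then the current $\xi_{t}$, $t\in[0,T]$, defined by (E2) satisfies (E3). Conversely, if $\xi\in C([0,T];\mathcal{M}_{w})$ is the unique current-valued solution of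 (E3) with $\xi_{0}$ defined by (E2) at $t=0$ from a given family of $C^{1}$ initial curves $\{\gamma_{0}^{i,N}(\sigma),\ i=1,\dots,N,\ \sigma\in[0,1]\}$, then the representation (E2) holds with \[ \gamma_{t}^{i,N}(\sigma)=\varphi^{t,K\ast\xi}\left(\gamma_{0}^{i,N}(\sigma)\right), \] and these curves $\gamma_{t}^{i,N}$ satisfy (E1).
   Context: $\mathcal{U}C_{b}^{3}(\mathbb{R}^{d},\mathbb{R}^{d\times d})$ denotes the $C^{3}$ functions bounded with all derivatives up to order 3 such that $K$, $DK$, $D^{2}K$ are uniformly continuous. $\mathcal{M}=C_{b}(\mathbb{R}^{d};\mathbb{R}^{d})'$ is the space of 1-currents; $\mathcal{M}_{w}$ is $\mathcal{M}$ endowed with the metric $d(\xi,\xi')=\sup\{(\xi-\xi')(\theta):\|\theta\|_{\infty}+\mathrm{Lip}(\theta)\le1\}$. For $\xi\in\mathcal{M}$, $K\ast\xi$ is the vector field with components $(K\ast\xi)_{i}(x)=\xi(K_{i\cdot}(x-\cdot))$, where $K_{i\cdot}(z)=(K_{ij}(z))_{j=1,\dots,d}$. For a time-dependent current $\xi$, $\varphi^{t,K\ast\xi}$ is the flow of diffeomorphisms generated by the ODE $\frac{dx_{t}}{dt}=(K\ast\xi_{t})(x_{t})$. For a $C^{1}$ map $\varphi$, the push-forward of a current is $(\varphi_{\sharp}\xi)(\theta)=\xi(\varphi_{\sharp}\theta)$ with $(\varphi_{\sharp}\theta)(x)=D\varphi(x)^{T}\theta(\varphi(x))$. *)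

theory Defs
  imports "HOL-Analysis.Analysis"
begin

text \<open>Currents: real-valued functionals on C_b(R^d;R^d); membership in M is bounded linearity.\<close>
type_synonym 'n current = "((real^'n) \<Rightarrow>\<^sub>C (real^'n)) \<Rightarrow> real"

definition UCb3 :: "(real^'n \<Rightarrow> real^'n^'n) \<Rightarrow> bool" where
  "UCb3 K \<longleftrightarrow>
    (\<exists>(K1 :: real^'n \<Rightarrow> ((real^'n) \<Rightarrow>\<^sub>L (real^'n^'n)))
       (K2 :: real^'n \<Rightarrow> ((real^'n) \<Rightarrow>\<^sub>L ((real^'n) \<Rightarrow>\<^sub>L (real^'n^'n))))
       (K3 :: real^'n \<Rightarrow> ((real^'n) \<Rightarrow>\<^sub>L ((real^'n) \<Rightarrow>\<^sub>L ((real^'n) \<Rightarrow>\<^sub>L (real^'n^'n))))).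
       (\<forall>x. (K has_derivative blinfun_apply (K1 x)) (at x)) \<and>
       (\<forall>x. (K1 has_derivative blinfun_apply (K2 x)) (at x)) \<and>
       (\<forall>x. (K2 has_derivative blinfun_apply (K3 x)) (at x)) \<and>
       continuous_on UNIV K3 \<and>
       bounded (range K) \<and> bounded (range K1) \<and> bounded (range K2) \<and> bounded (range K3) \<and>
       uniformly_continuous_on UNIV K \<and> uniformly_continuous_on UNIV K1 \<and>
       uniformly_continuous_on UNIV K2)"

definition C1_rect :: "real \<Rightarrow> (real \<Rightarrow> real \<Rightarrow> real^'n) \<Rightarrow> bool" where
  "C1_rect T \<gamma> \<longleftrightarrow>
    (\<exists>dt ds. continuous_on ({0..T} \<times> {0..1}) (\<lambda>p. dt (fst p) (snd p)) \<and>
       continuous_on ({0..T} \<times> {0..1}) (\<lambda>p. ds (fst p) (snd p)) \<and>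
       (\<forall>t\<in>{0..T}. \<forall>\<sigma>\<in>{0..1}.
          ((\<lambda>\<tau>. \<gamma> \<tau> \<sigma>) has_vector_derivative dt t \<sigma>) (at t within {0..T}) \<and>
          ((\<lambda>s. \<gamma> t s) has_vector_derivative ds t \<sigma>) (at \<sigma> within {0..1})))"

definition C1_curve :: "(real \<Rightarrow> real^'n) \<Rightarrow> bool" where
  "C1_curve c \<longleftrightarrow> (\<exists>g. continuous_on {0..1} g \<and>
      (\<forall>\<sigma>\<in>{0..1}. (c has_vector_derivative g \<sigma>) (at \<sigma> within {0..1})))"

definition curve_current :: "(nat \<Rightarrow> real) \<Rightarrow> nat \<Rightarrow> (nat \<Rightarrow> real \<Rightarrow> real^'n) \<Rightarrow> 'n current" where
  "curve_current \<alpha> N c \<theta> =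
     (\<Sum>j=1..N. \<alpha> j * integral {0..1}
        (\<lambda>\<sigma>. \<theta> (c j \<sigma>) \<bullet> vector_derivative (c j) (at \<sigma> within {0..1})))"

definition interacting_curves ::
  "(real^'n \<Rightarrow> real^'n^'n) \<Rightarrow> (nat \<Rightarrow> real) \<Rightarrow> nat \<Rightarrow> real \<Rightarrow> (nat \<Rightarrow> real \<Rightarrow> real \<Rightarrow> real^'n) \<Rightarrow> bool" where
  "interacting_curves K \<alpha> N T \<gamma> \<longleftrightarrow>
    (\<forall>i\<in>{1..N}. \<forall>t\<in>{0..T}. \<forall>\<sigma>\<in>{0..1}.
       vector_derivative (\<lambda>\<tau>. \<gamma> i \<tau> \<sigma>) (at t within {0..T}) =
       (\<Sum>j=1..N. \<alpha> j *\<^sub>R integral {0..1}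
          (\<lambda>\<sigma>'. K (\<gamma> i t \<sigma> - \<gamma> j t \<sigma>') *v vector_derivative (\<gamma> j t) (at \<sigma>' within {0..1}))))"

definition conv :: "(real^'n \<Rightarrow> real^'n^'n) \<Rightarrow> 'n current \<Rightarrow> real^'n \<Rightarrow> real^'n" where
  "conv K \<xi> x = (\<chi> i. \<xi> (Bcontfun (\<lambda>y. K (x - y) $ i)))"

definition flow :: "(real \<Rightarrow> real^'n \<Rightarrow> real^'n) \<Rightarrow> real \<Rightarrow> real^'n \<Rightarrow> real^'n" where
  "flow v t x = (THE z. \<exists>y. y 0 = x \<and>
      (\<forall>s\<in>{0..t}. (y has_vector_derivative v s (y s)) (at s within {0..t})) \<and> y t = z)"

definition push_test :: "(real^'n \<Rightarrow> real^'n) \<Rightarrow> ((real^'n) \<Rightarrow>\<^sub>C (real^'n)) \<Rightarrow> ((real^'n) \<Rightarrow>\<^sub>C (real^'n))" where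
  "push_test \<phi> \<theta> = Bcontfun (\<lambda>x. transpose (matrix (frechet_derivative \<phi> (at x))) *v \<theta> (\<phi> x))"

definition push :: "(real^'n \<Rightarrow> real^'n) \<Rightarrow> 'n current \<Rightarrow> 'n current" where
  "push \<phi> \<xi> \<theta> = \<xi> (push_test \<phi> \<theta>)"

definition flow_eq :: "(real^'n \<Rightarrow> real^'n^'n) \<Rightarrow> real \<Rightarrow> (real \<Rightarrow> 'n current) \<Rightarrow> bool" where
  "flow_eq K T \<xi> \<longleftrightarrow> (\<forall>t\<in>{0..T}. \<xi> t = push (flow (\<lambda>s. conv K (\<xi> s)) t) (\<xi> 0))"

definition dist_w :: "('n::finite) current \<Rightarrow> 'n current \<Rightarrow> real" where
  "dist_w \<xi> \<xi>' = Sup {\<xi> \<theta> - \<xi>' \<theta> | \<theta>.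
      \<exists>L. L-lipschitz_on UNIV (apply_bcontfun \<theta>) \<and> norm \<theta> + L \<le> 1}"

definition is_current :: "('n::finite) current \<Rightarrow> bool" where
  "is_current \<xi> \<longleftrightarrow> bounded_linear \<xi>"

definition cont_Mw :: "real \<Rightarrow> (real \<Rightarrow> ('n::finite) current) \<Rightarrow> bool" where
  "cont_Mw T \<xi> \<longleftrightarrow> (\<forall>t\<in>{0..T}. is_current (\<xi> t)) \<and>
     (\<forall>t\<in>{0..T}. ((\<lambda>s. dist_w (\<xi> s) (\<xi> t)) \<longlongrightarrow> 0) (at t within {0..T}))"

end

theory Submission
  imports Defs
begin

text \<open>
  A weakly continuous family of currents \<open>\<xi>\<close> is bounded in the dual bounded-Lipschitz norm on
  \<open>[0,T]\<close>, so \<open>K * \<xi>\<close> is a time-continuous field whose space derivative is bounded and Lipschitz.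
  Its flow is then globally defined and \<open>C\<^sup>1\<close> in space, with derivative given by the linearised
  equation; all estimates are Gronwall estimates. By the chain rule, pushing the current of a
  family of curves forward along the flow gives the current of the transported curves. For the
  current of a family of curves, \<open>K * \<xi>\<close> evaluated on the curves is the right-hand side of the
  interaction equation: solutions of that equation are transported by the flow because
  \<open>y' = (K * \<xi>)(y)\<close> has unique solutions, and conversely transported curves solve it.
\<close>

section \<open>Ordinary differential equations with a globally Lipschitz field\<close>

text \<open>A Lipschitz, rather than merely continuous, space derivative makes every linearisation
  error quadratic, and one Gronwall lemma then serves all purposes: with \<open>c = 0\<close> it
  gives uniqueness and Lipschitz dependence on the starting point, with \<open>c\<close> of first
  order Lipschitz dependence of the derivative, with \<open>c\<close> of second order
  differentiability. Uniform Lipschitz constants also turn separate continuity in time and space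
  into joint continuity. Definitions by description shape the rest. \<open>flow\<close> is a
  \<open>THE\<close> over solutions on \<open>[0,t]\<close>, so existence and uniqueness must be
  known before it denotes a solution. \<open>conv\<close> and \<open>push_test\<close> go through
  \<open>Bcontfun\<close>, whose value is meaningful only for bounded continuous functions, so the
  derivative of the flow must be bounded and continuous in space before a push-forward can be
  computed. The two implications differ in where weak continuity comes from: the converse assumes
  it, while the direct one must prove it for the current of the given curves before the flow is
  available.\<close>

lemma has_integral_norm_bound:
  fixes f :: "'n::euclidean_space \<Rightarrow> 'a::banach"
  assumes "(f has_integral i) S" and "(g has_integral j) S"
    and "\<And>x. x \<in> S \<Longrightarrow> norm (f x) \<le> g x"
  shows "norm i \<le> j"
  using has_integral_norm_bound_integral_component[of f i S g j 1] assms by simp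

text \<open>The norm of \<open>r\<close> may fail to be differentiable where \<open>r\<close>
  vanishes, so the bound on \<open>r'\<close> is first integrated, and the resulting integral
  inequality is solved instead. The constant involves \<open>T\<close> and not \<open>t\<close>,
  hence is uniform in time.\<close>

lemma gronwall_norm:
  fixes r r' :: "real \<Rightarrow> 'a::banach"
  assumes deriv: "\<And>s. s \<in> {0..T} \<Longrightarrow> (r has_vector_derivative r' s) (at s within {0..T})"
    and bound: "\<And>s. s \<in> {0..T} \<Longrightarrow> norm (r' s) \<le> L * norm (r s) + c"
    and "0 \<le> L" "0 \<le> c" and t: "t \<in> {0..T}"
  shows "norm (r t) \<le> (norm (r 0) + c * T) * exp (L * T)"
proof -
  define A where "A = norm (r 0) + c * T"
  have T: "0 \<le> T" using t by auto
  have A0: "0 \<le> A" using T \<open>0 \<le> c\<close> by (simp add: A_def)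
  have contr: "continuous_on {0..T} r"
    using deriv by (rule continuous_on_vector_derivative)
  have contn: "continuous_on {0..T} (\<lambda>s. norm (r s))"
    by (intro continuous_intros contr)
  define G where "G = (\<lambda>s. integral {0..s} (\<lambda>s. norm (r s)))"
  have le: "norm (r s) \<le> A + L * G s" if s: "s \<in> {0..T}" for s
  proof -
    have sub: "{0..s} \<subseteq> {0..T}" using s by auto
    have ri: "(r' has_integral (r s - r 0)) {0..s}"
      using s deriv by (intro fundamental_theorem_of_calculus)
        (auto intro: has_vector_derivative_within_subset[OF _ sub])
    have ni: "(\<lambda>s. norm (r s)) integrable_on {0..s}"
      by (intro integrable_continuous_real continuous_on_subset[OF contn sub])
    have "((\<lambda>u. L * norm (r u) + c) has_integral (L * G s + c * s)) {0..s}"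
      using has_integral_add[OF has_integral_mult_right[OF integrable_integral[OF ni], of L]
        has_integral_const_real[of c 0 s]] s
      by (simp add: G_def mult.commute)
    from has_integral_norm_bound[OF ri this] have "norm (r s - r 0) \<le> L * G s + c * s"
      using s bound by force
    moreover have "c * s \<le> c * T" using s \<open>0 \<le> c\<close> by (auto intro: mult_left_mono)
    ultimately show ?thesis
      using norm_triangle_sub[of "r s" "r 0"] unfolding A_def by linarith
  qed
  have Gd: "(G has_real_derivative norm (r s)) (at s within {0..T})" if "s \<in> {0..T}" for s
    unfolding G_def has_real_derivative_iff_has_vector_derivative
    by (rule integral_has_vector_derivative[OF contn that])
  \<comment> \<open>Integrating factor: by \<open>le\<close>, the product
    \<open>exp (- L * s) * (A + L * G s)\<close> has nonpositive derivative, so it stays below its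
    initial value \<open>A\<close>.\<close>
  have "exp (- L * t) * (A + L * G t) \<le> exp (- L * 0) * (A + L * G 0)"
  proof (rule DERIV_nonpos_imp_decreasing_open[where f = "\<lambda>s. exp (- L * s) * (A + L * G s)"])
    show "0 \<le> t" using t by auto
    show "\<exists>y. ((\<lambda>s. exp (- L * s) * (A + L * G s)) has_real_derivative y) (at x) \<and> y \<le> 0"
      if x: "0 < x" "x < t" for x
    proof (intro exI conjI)
      have "x \<in> interior {0..T}" using x t by auto
      then have Gx: "(G has_real_derivative norm (r x)) (at x)"
        using Gd[of x] x t at_within_interior[of x "{0..T}"] by auto
      show "((\<lambda>s. exp (- L * s) * (A + L * G s)) has_real_derivative
         exp (- L * x) * L * (norm (r x) - (A + L * G x))) (at x)"
        by (rule derivative_eq_intros Gx refl | simp add: algebra_simps)+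
      show "exp (- L * x) * L * (norm (r x) - (A + L * G x)) \<le> 0"
        using le[of x] x t \<open>0 \<le> L\<close> by (intro mult_nonneg_nonpos) auto
    qed
    have "continuous_on {0..T} G"
      by (rule DERIV_continuous_on[OF Gd])
    then have "continuous_on {0..t} G"
      by (rule continuous_on_subset) (use t in auto)
    then show "continuous_on {0..t} (\<lambda>s. exp (- L * s) * (A + L * G s))"
      by (intro continuous_intros)
  qed
  also have "\<dots> = A" by (simp add: G_def)
  finally have "A + L * G t \<le> A * exp (L * t)"
    by (simp add: exp_minus field_simps)
  also have "\<dots> \<le> A * exp (L * T)"
    using A0 t \<open>0 \<le> L\<close> by (intro mult_left_mono) (auto intro: mult_left_mono)
  finally show ?thesis using le[OF t] by (simp add: A_def)
qed

lemma picard_global: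
  fixes f :: "real \<Rightarrow> 'a::banach \<Rightarrow> 'a"
  assumes cont: "\<And>y. continuous_on {0..T} y \<Longrightarrow> continuous_on {0..T} (\<lambda>s. f s (y s))"
    and lip: "\<And>s x y. s \<in> {0..T} \<Longrightarrow> norm (f s x - f s y) \<le> L * norm (x - y)"
    and T: "0 \<le> T" and L: "0 \<le> L"
  shows "\<exists>y. y 0 = x0 \<and> (\<forall>s\<in>{0..T}. (y has_vector_derivative f s (y s)) (at s within {0..T}))"
proof -
  \<comment> \<open>Banach's fixed point theorem for \<open>u(t) = exp(-lt) y(t)\<close>: the weight makes the Picard map a contraction on all of \<open>[0,T]\<close>.\<close>
  define l where "l = 2 * L + 1"
  \<comment> \<open>The factor 2 in \<open>l\<close> yields the contraction constant 1/2; the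
    summand 1 keeps \<open>l\<close> positive when \<open>L = 0\<close>.\<close>
  have l: "l > 0" "L / l \<le> 1 / 2" using L by (auto simp: l_def field_simps)
  \<comment> \<open>Clamping time to \<open>[0,T]\<close> extends continuous functions on the
    interval to bounded continuous ones on the line, so the fixed point can be sought in the
    complete type of such functions.\<close>
  define p where "p = (\<lambda>t. max 0 (min T t))"
  have p: "p t \<in> {0..T}" "t \<in> {0..T} \<Longrightarrow> p t = t" for t using T by (auto simp: p_def)
  define F where "F = (\<lambda>(u :: real \<Rightarrow>\<^sub>C 'a) s. f s (exp (l * s) *\<^sub>R u s))"
  define G where "G = (\<lambda>u t. exp (- l * t) *\<^sub>R (x0 + integral {0..t} (F u)))"
  have contF: "continuous_on {0..T} (F u)" for u
    unfolding F_def by (intro cont continuous_intros) auto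
  have contG: "continuous_on {0..T} (G u)" for u
    unfolding G_def
    by (intro continuous_intros indefinite_integral_continuous_1 integrable_continuous_real contF)
  have mem: "(\<lambda>t. G u (p t)) \<in> bcontfun" for u
  proof -
    have "continuous_on UNIV p" unfolding p_def by (intro continuous_intros)
    then have "continuous_on UNIV (\<lambda>t. G u (p t))"
      by (rule continuous_on_compose2[OF contG]) (use p in auto)
    moreover have "bounded (range (\<lambda>t. G u (p t)))"
      by (rule bounded_subset[OF compact_imp_bounded[OF compact_continuous_image[OF contG]]])
        (use p in auto)
    ultimately show ?thesis by (simp add: bcontfun_def)
  qed
  define P where "P = (\<lambda>u. Bcontfun (\<lambda>t. G u (p t)))"
  have P: "apply_bcontfun (P u) t = G u (p t)" for u t
    unfolding P_def using Bcontfun_inverse[OF mem] by simp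
  have contr: "norm (G u t - G w t) \<le> 1 / 2 * dist u w" if t: "t \<in> {0..T}" for u w t
  proof -
    have sub: "{0..t} \<subseteq> {0..T}" using t by auto
    have int: "F u integrable_on {0..t}" for u
      by (intro integrable_continuous_real continuous_on_subset[OF contF sub])
    have e: "((\<lambda>s. exp (l * s)) has_integral (exp (l * t) / l - exp (l * 0) / l)) {0..t}"
      using t l by (intro fundamental_theorem_of_calculus)
        (auto simp: has_real_derivative_iff_has_vector_derivative[symmetric]
          intro!: derivative_eq_intros)
    have "norm (integral {0..t} (F u) - integral {0..t} (F w))
        \<le> L * dist u w * (exp (l * t) / l - exp (l * 0) / l)"
    proof (rule has_integral_norm_bound)
      show "((\<lambda>s. F u s - F w s) has_integral (integral {0..t} (F u) - integral {0..t} (F w))) {0..t}"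
        by (intro has_integral_diff integrable_integral int)
      show "((\<lambda>s. L * dist u w * exp (l * s)) has_integral
          L * dist u w * (exp (l * t) / l - exp (l * 0) / l)) {0..t}"
        by (rule has_integral_mult_right[OF e])
      fix s assume "s \<in> {0..t}"
      then have "norm (F u s - F w s) \<le> L * norm (exp (l * s) *\<^sub>R u s - exp (l * s) *\<^sub>R w s)"
        unfolding F_def using sub by (intro lip) auto
      also have "\<dots> = L * (exp (l * s) * dist (u s) (w s))"
        by (simp add: dist_norm flip: scaleR_diff_right)
      also have "\<dots> \<le> L * (exp (l * s) * dist u w)"
        using L by (intro mult_left_mono dist_bounded) auto
      finally show "norm (F u s - F w s) \<le> L * dist u w * exp (l * s)" by (simp add: mult_ac)
    qed
    also have "\<dots> \<le> L * dist u w * (exp (l * t) / l)"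
      using L l by (intro mult_left_mono) auto
    also have "\<dots> = (L / l) * dist u w * exp (l * t)" by simp
    also have "\<dots> \<le> 1 / 2 * dist u w * exp (l * t)"
      using l by (intro mult_right_mono) auto
    finally have "norm (integral {0..t} (F u) - integral {0..t} (F w)) \<le> 1 / 2 * dist u w * exp (l * t)" .
    moreover have "G u t - G w t = exp (- l * t) *\<^sub>R (integral {0..t} (F u) - integral {0..t} (F w))"
      by (simp add: G_def algebra_simps)
    ultimately have "norm (G u t - G w t) \<le> exp (- l * t) * (1 / 2 * dist u w * exp (l * t))"
      by simp
    also have "\<dots> = 1 / 2 * dist u w" by (simp add: exp_minus)
    finally show ?thesis .
  qed
  have "\<exists>!u. P u = u"
  proof (rule banach_fix_type[of "1 / 2"])
    show "\<forall>u w. dist (P u) (P w) \<le> 1 / 2 * dist u w"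
      using contr p by (intro allI dist_bound) (auto simp: P dist_norm)
  qed auto
  then obtain u where u: "P u = u" by auto
  define y where "y = (\<lambda>t. exp (l * t) *\<^sub>R u t)"
  have Fu: "F u = (\<lambda>s. f s (y s))" by (simp add: F_def y_def)
  have y: "y t = x0 + integral {0..t} (\<lambda>s. f s (y s))" if "t \<in> {0..T}" for t
  proof -
    have "u t = G u t" using P[of u t] p(2)[OF that] u by simp
    then show ?thesis
      unfolding y_def using Fu by (simp add: G_def exp_minus y_def)
  qed
  have cf: "continuous_on {0..T} (\<lambda>s. f s (y s))" using contF[of u] Fu by simp
  have "(y has_vector_derivative f s (y s)) (at s within {0..T})" if s: "s \<in> {0..T}" for s
  proof (rule has_vector_derivative_transform[OF s])
    show "y t = x0 + integral {0..t} (\<lambda>s. f s (y s))" if "t \<in> {0..T}" for t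
      using that by (rule y)
    show "((\<lambda>t. x0 + integral {0..t} (\<lambda>s. f s (y s))) has_vector_derivative f s (y s)) (at s within {0..T})"
      using has_vector_derivative_add[OF has_vector_derivative_const integral_has_vector_derivative[OF cf s]]
      by simp
  qed
  moreover have "y 0 = x0" using y[of 0] T by simp
  ultimately show ?thesis by blast
qed

section \<open>Quadratic remainders and joint continuity from Lipschitz bounds\<close>

text \<open>Divided by \<open>norm (y - x)\<close>, a quadratic remainder leaves a linear bound that
  vanishes at \<open>x\<close>. This replaces the limit in differentiability by an inequality that
  Gronwall and convolution estimates can deliver.\<close>

lemma has_derivative_quadraticI:
  fixes f :: "'a::real_normed_vector \<Rightarrow> 'b::real_normed_vector"
  assumes "bounded_linear A" and "\<And>y. norm (f y - f x - A (y - x)) \<le> C * norm (y - x) ^ 2"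
  shows "(f has_derivative A) (at x)"
  unfolding has_derivative_at_within
proof (rule conjI[OF assms(1)], rule Lim_null_comparison)
  show "\<forall>\<^sub>F y in at x. norm ((f y - f x - A (y - x)) /\<^sub>R norm (y - x)) \<le> C * norm (y - x)"
  proof (rule always_eventually, rule allI)
    fix y
    show "norm ((f y - f x - A (y - x)) /\<^sub>R norm (y - x)) \<le> C * norm (y - x)"
    proof (cases "y = x")
      case False
      then have pos: "0 < norm (y - x)" by simp
      have "norm (f y - f x - A (y - x)) / norm (y - x) \<le> C * norm (y - x)"
        unfolding pos_divide_le_eq[OF pos]
        using assms(2)[of y] by (simp only: power2_eq_square mult.assoc)
      then show ?thesis
        by (simp only: norm_scaleR abs_inverse abs_norm_cancel divide_inverse mult.commute)
    qed simp
  qed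
  have "((\<lambda>y. C * norm (y - x)) \<longlongrightarrow> C * norm (x - x)) (at x)" by (intro tendsto_intros)
  then show "((\<lambda>y. C * norm (y - x)) \<longlongrightarrow> 0) (at x)" by simp
qed

text \<open>On the ball of radius \<open>norm (y - x)\<close> around \<open>x\<close> the derivative
  differs from \<open>f' x\<close> by at most \<open>M\<close> times the radius; the mean value
  inequality multiplies this by the radius once more. Using that inequality instead of an integral
  gives the constant \<open>M\<close> and not \<open>M / 2\<close>.\<close>

lemma taylor_remainder_lipschitz:
  fixes f :: "'a::real_normed_vector \<Rightarrow> 'b::real_normed_vector"
  assumes der: "\<And>x. (f has_derivative blinfun_apply (f' x)) (at x)"
    and lip: "\<And>x y. norm (f' x - f' y) \<le> M * norm (x - y)"
    and M: "0 \<le> M"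
  shows "norm (f y - f x - f' x (y - x)) \<le> M * norm (y - x) ^ 2"
proof -
  have "norm (f y - f x - f' x (y - x)) \<le> norm (y - x) * (M * norm (y - x))"
  proof (rule differentiable_bound_linearization[where S = "cball x (norm (y - x))"])
    show "x + t *\<^sub>R (y - x) \<in> cball x (norm (y - x))" if "t \<in> {0..1}" for t
      using that by (auto simp: dist_norm mult_left_le_one_le)
    show "(f has_derivative f' z) (at z within cball x (norm (y - x)))" for z
      using der by (rule has_derivative_at_withinI)
    show "onorm (blinfun_apply (f' z) - blinfun_apply (f' x)) \<le> M * norm (y - x)"
      if "z \<in> cball x (norm (y - x))" for z
    proof -
      have "onorm (blinfun_apply (f' z) - blinfun_apply (f' x)) = norm (f' z - f' x)"
        by (simp add: norm_blinfun.rep_eq minus_blinfun.rep_eq fun_diff_def)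
      also have "\<dots> \<le> M * norm (z - x)" by (rule lip)
      also have "\<dots> \<le> M * norm (y - x)"
        using that M by (intro mult_left_mono) (auto simp: dist_norm norm_minus_commute)
      finally show ?thesis .
    qed
  qed auto
  then show ?thesis by (simp add: power2_eq_square mult_ac)
qed

lemma lipschitz_of_blinfun_derivative:
  fixes f :: "'a::real_normed_vector \<Rightarrow> 'b::real_normed_vector"
  assumes "\<And>x. (f has_derivative blinfun_apply (f' x)) (at x)" and "\<And>x. norm (f' x) \<le> M"
  shows "norm (f x - f y) \<le> M * norm (x - y)"
  by (rule differentiable_bound[where S = UNIV and f' = "\<lambda>x. blinfun_apply (f' x)"])
    (use assms in \<open>auto simp: norm_blinfun.rep_eq\<close>)

text \<open>Separate continuity alone does not give joint continuity. A Lipschitz constant in the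
  second variable that does not depend on the first closes the gap: the second variable is moved at
  the current \<open>s\<close>, then \<open>s\<close> is moved at a fixed point.\<close>

lemma continuous_on_prod_lipschitz_snd:
  fixes g :: "'a::metric_space \<Rightarrow> 'b::real_normed_vector \<Rightarrow> 'c::real_normed_vector"
  assumes cont: "\<And>x. x \<in> X \<Longrightarrow> continuous_on S (\<lambda>s. g s x)"
    and lip: "\<And>s x y. s \<in> S \<Longrightarrow> x \<in> X \<Longrightarrow> y \<in> X \<Longrightarrow> norm (g s x - g s y) \<le> L * norm (x - y)"
  shows "continuous_on (S \<times> X) (\<lambda>p. g (fst p) (snd p))"
  unfolding continuous_on_def
proof
  fix p assume p: "p \<in> S \<times> X"
  let ?F = "at p within S \<times> X"
  have 1: "((\<lambda>q. g (fst q) (snd p)) \<longlongrightarrow> g (fst p) (snd p)) ?F"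
  proof -
    have "continuous_on (S \<times> X) (\<lambda>q :: 'a \<times> 'b. g (fst q) (snd p))"
      by (rule continuous_on_compose2[OF cont]) (use p in \<open>auto intro!: continuous_intros\<close>)
    then show ?thesis using p by (auto simp: continuous_on_def)
  qed
  have 2: "((\<lambda>q. g (fst q) (snd q) - g (fst q) (snd p)) \<longlongrightarrow> 0) ?F"
  proof (rule Lim_null_comparison)
    show "\<forall>\<^sub>F q in ?F. norm (g (fst q) (snd q) - g (fst q) (snd p)) \<le> L * norm (snd q - snd p)"
      unfolding eventually_at_filter by (rule always_eventually) (use p in \<open>auto intro: lip\<close>)
    have "((\<lambda>q. L * norm (snd q - snd p)) \<longlongrightarrow> L * norm (snd p - snd p)) ?F"
      by (intro tendsto_intros)
    then show "((\<lambda>q. L * norm (snd q - snd p)) \<longlongrightarrow> 0) ?F" by simp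
  qed
  show "((\<lambda>q. g (fst q) (snd q)) \<longlongrightarrow> g (fst p) (snd p)) ?F"
    using tendsto_add[OF 1 2] by simp
qed

section \<open>Differentiability of the flow\<close>

text \<open>Interface between the ODE theory and currents. Time regularity is asked only pointwise
  in space, since \<open>L\<close> and \<open>M\<close>, uniform in time, upgrade it to joint
  continuity.\<close>

locale smooth_field =
  fixes v :: "real \<Rightarrow> 'a::banach \<Rightarrow> 'a" and v' :: "real \<Rightarrow> 'a \<Rightarrow> 'a \<Rightarrow>\<^sub>L 'a" and T L M :: real
  assumes T_nonneg: "0 \<le> T" and M_nonneg: "0 \<le> M"
    and cont_v: "\<And>x. continuous_on {0..T} (\<lambda>s. v s x)"
    and cont_v': "\<And>x. continuous_on {0..T} (\<lambda>s. v' s x)"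
    and deriv_v: "\<And>s x. s \<in> {0..T} \<Longrightarrow> (v s has_derivative blinfun_apply (v' s x)) (at x)"
    and bound_v': "\<And>s x. s \<in> {0..T} \<Longrightarrow> norm (v' s x) \<le> L"
    and lip_v': "\<And>s x y. s \<in> {0..T} \<Longrightarrow> norm (v' s x - v' s y) \<le> M * norm (x - y)"
begin

lemma L_nonneg: "0 \<le> L"
  using order_trans[OF norm_ge_zero bound_v'[of 0 0]] T_nonneg by simp

lemma lip_v: "s \<in> {0..T} \<Longrightarrow> norm (v s x - v s y) \<le> L * norm (x - y)"
  using lipschitz_of_blinfun_derivative[of "v s" "v' s" L x y] deriv_v bound_v' by blast

lemma continuous_on_v:
  assumes "continuous_on S g" "continuous_on S y" "g ` S \<subseteq> {0..T}"
  shows "continuous_on S (\<lambda>p. v (g p) (y p))"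
  using continuous_on_compose2[OF continuous_on_prod_lipschitz_snd[of UNIV "{0..T}" v L, OF cont_v lip_v],
      of S "\<lambda>p. (g p, y p)"] assms
  by (auto intro!: continuous_on_Pair)

lemma continuous_on_v':
  assumes "continuous_on S g" "continuous_on S y" "g ` S \<subseteq> {0..T}"
  shows "continuous_on S (\<lambda>p. v' (g p) (y p))"
  using continuous_on_compose2[OF continuous_on_prod_lipschitz_snd[of UNIV "{0..T}" v' M, OF cont_v' lip_v'],
      of S "\<lambda>p. (g p, y p)"] assms
  by (auto intro!: continuous_on_Pair)

text \<open>Unlike \<open>flow\<close>, which poses a new problem on \<open>[0,t]\<close> for each
  \<open>t\<close>, this selects one trajectory on all of \<open>[0,T]\<close>, which can be
  differentiated in time. Its values outside \<open>[0,T]\<close> are arbitrary.\<close>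

definition sol :: "'a \<Rightarrow> real \<Rightarrow> 'a" where
  "sol x = (SOME y. y 0 = x \<and>
     (\<forall>s\<in>{0..T}. (y has_vector_derivative v s (y s)) (at s within {0..T})))"

lemma sol: "sol x 0 = x"
  "s \<in> {0..T} \<Longrightarrow> (sol x has_vector_derivative v s (sol x s)) (at s within {0..T})"
proof -
  have "\<exists>y. y 0 = x \<and> (\<forall>s\<in>{0..T}. (y has_vector_derivative v s (y s)) (at s within {0..T}))"
    by (rule picard_global[of T v L])
      (auto intro!: continuous_on_v continuous_intros lip_v T_nonneg L_nonneg)
  from someI_ex[OF this] show "sol x 0 = x"
    "s \<in> {0..T} \<Longrightarrow> (sol x has_vector_derivative v s (sol x s)) (at s within {0..T})"
    unfolding sol_def by blast+
qed

lemma continuous_on_sol: "continuous_on {0..T} (sol x)"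
  by (rule continuous_on_vector_derivative[OF sol(2)])

text \<open>Stated on \<open>[0,t]\<close> because \<open>flow\<close> quantifies over solutions
  there; Gronwall is applied with zero initial difference and no source.\<close>

lemma sol_unique:
  assumes t: "t \<in> {0..T}" and y0: "y 0 = x"
    and y: "\<And>s. s \<in> {0..t} \<Longrightarrow> (y has_vector_derivative v s (y s)) (at s within {0..t})"
  shows "y t = sol x t"
proof -
  have "norm (y t - sol x t) \<le> (norm (y 0 - sol x 0) + 0 * t) * exp (L * t)"
  proof (rule gronwall_norm)
    fix s assume s: "s \<in> {0..t}"
    show "((\<lambda>s. y s - sol x s) has_vector_derivative v s (y s) - v s (sol x s)) (at s within {0..t})"
      by (intro has_vector_derivative_diff y s has_vector_derivative_within_subset[OF sol(2)])
        (use s t in auto)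
    show "norm (v s (y s) - v s (sol x s)) \<le> L * norm (y s - sol x s) + 0"
      using lip_v[of s] s t by auto
  qed (use t L_nonneg in auto)
  then show ?thesis by (simp add: sol y0)
qed

lemma sol_lipschitz:
  assumes t: "t \<in> {0..T}"
  shows "norm (sol x t - sol y t) \<le> exp (L * T) * norm (x - y)"
proof -
  have "norm (sol x t - sol y t) \<le> (norm (sol x 0 - sol y 0) + 0 * T) * exp (L * T)"
  proof (rule gronwall_norm[OF _ _ L_nonneg _ t])
    fix s assume s: "s \<in> {0..T}"
    show "((\<lambda>s. sol x s - sol y s) has_vector_derivative v s (sol x s) - v s (sol y s)) (at s within {0..T})"
      by (intro has_vector_derivative_diff sol s)
    show "norm (v s (sol x s) - v s (sol y s)) \<le> L * norm (sol x s - sol y s) + 0"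
      using lip_v[OF s] by simp
  qed auto
  then show ?thesis by (simp add: sol mult.commute)
qed

text \<open>Solves the linearised equation along \<open>sol x\<close>, and turns out to be the space derivative of the flow.\<close>
definition dsol :: "'a \<Rightarrow> real \<Rightarrow> 'a \<Rightarrow>\<^sub>L 'a" where
  "dsol x = (SOME Z. Z 0 = id_blinfun \<and>
     (\<forall>s\<in>{0..T}. (Z has_vector_derivative v' s (sol x s) o\<^sub>L Z s) (at s within {0..T})))"

lemma norm_v'_compose_le:
  assumes "s \<in> {0..T}" shows "norm (v' s x o\<^sub>L Z) \<le> L * norm Z"
  using norm_blinfun_compose[of "v' s x" Z] bound_v'[OF assms, of x]
  by (meson mult_right_mono norm_ge_zero order_trans)

text \<open>The linearised equation is itself an ODE, in the Banach space of bounded operators, and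
  composition with \<open>v' s (sol x s)\<close> is Lipschitz with the same \<open>L\<close>; the
  existence theorem applies a second time.\<close>

lemma dsol: "dsol x 0 = id_blinfun"
  "s \<in> {0..T} \<Longrightarrow> (dsol x has_vector_derivative v' s (sol x s) o\<^sub>L dsol x s) (at s within {0..T})"
proof -
  have "\<exists>Z. Z 0 = id_blinfun \<and>
     (\<forall>s\<in>{0..T}. (Z has_vector_derivative v' s (sol x s) o\<^sub>L Z s) (at s within {0..T}))"
  proof (rule picard_global[of T _ L])
    fix Z :: "real \<Rightarrow> 'a \<Rightarrow>\<^sub>L 'a" assume "continuous_on {0..T} Z"
    then show "continuous_on {0..T} (\<lambda>s. v' s (sol x s) o\<^sub>L Z s)"
      by (intro bounded_bilinear.continuous_on[OF bounded_bilinear_blinfun_compose]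
          continuous_on_v' continuous_on_sol) auto
  next
    fix s and Z W :: "'a \<Rightarrow>\<^sub>L 'a" assume s: "s \<in> {0..T}"
    have "(v' s (sol x s) o\<^sub>L Z) - (v' s (sol x s) o\<^sub>L W) = v' s (sol x s) o\<^sub>L (Z - W)"
      by (rule bounded_bilinear.diff_right[OF bounded_bilinear_blinfun_compose, symmetric])
    then show "norm ((v' s (sol x s) o\<^sub>L Z) - (v' s (sol x s) o\<^sub>L W)) \<le> L * norm (Z - W)"
      using norm_v'_compose_le[OF s] by simp
  qed (use T_nonneg L_nonneg in auto)
  from someI_ex[OF this] show "dsol x 0 = id_blinfun"
    "s \<in> {0..T} \<Longrightarrow> (dsol x has_vector_derivative v' s (sol x s) o\<^sub>L dsol x s) (at s within {0..T})"
    unfolding dsol_def by blast+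
qed

lemma continuous_on_dsol: "continuous_on {0..T} (dsol x)"
  by (rule continuous_on_vector_derivative[OF dsol(2)])

lemma norm_dsol_le:
  assumes t: "t \<in> {0..T}" shows "norm (dsol x t) \<le> exp (L * T)"
proof -
  have "norm (dsol x t) \<le> (norm (dsol x 0) + 0 * T) * exp (L * T)"
    by (rule gronwall_norm[OF dsol(2) _ L_nonneg _ t]) (use norm_v'_compose_le in auto)
  \<comment> \<open>Only an inequality for the norm of the identity: it is 0 if the space is
    trivial.\<close>
  also have "\<dots> \<le> 1 * exp (L * T)"
    using norm_blinfun_id_le[where 'a = 'a] by (intro mult_right_mono) (auto simp: dsol)
  finally show ?thesis by simp
qed

text \<open>The difference solves the linearised equation with a source of size \<open>c\<close>. Of
  the three exponentials one comes from \<open>sol_lipschitz\<close>, one from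
  \<open>norm_dsol_le\<close> and one from Gronwall; \<open>T\<close> is the time during which the
  source acts.\<close>

lemma dsol_lipschitz:
  assumes t: "t \<in> {0..T}"
  shows "norm (dsol x t - dsol y t) \<le> M * exp (L * T) ^ 3 * T * norm (x - y)"
proof -
  define c where "c = M * (exp (L * T) * norm (x - y)) * exp (L * T)"
  have "norm (dsol x t - dsol y t) \<le> (norm (dsol x 0 - dsol y 0) + c * T) * exp (L * T)"
  proof (rule gronwall_norm[OF _ _ L_nonneg _ t])
    fix s assume s: "s \<in> {0..T}"
    show "((\<lambda>s. dsol x s - dsol y s) has_vector_derivative
        (v' s (sol x s) o\<^sub>L dsol x s) - (v' s (sol y s) o\<^sub>L dsol y s)) (at s within {0..T})"
      by (intro has_vector_derivative_diff dsol s)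
    \<comment> \<open>Inserting \<open>v' s (sol y s) o\<^sub>L dsol x s\<close> separates the
      homogeneous part from the source.\<close>
    have eq: "(v' s (sol x s) o\<^sub>L dsol x s) - (v' s (sol y s) o\<^sub>L dsol y s) =
      (v' s (sol y s) o\<^sub>L (dsol x s - dsol y s)) + ((v' s (sol x s) - v' s (sol y s)) o\<^sub>L dsol x s)"
      by (simp add: blinfun_eqI blinfun.diff_left blinfun.diff_right blinfun.add_left)
    have "norm (v' s (sol x s) - v' s (sol y s)) \<le> M * (exp (L * T) * norm (x - y))"
      by (rule order_trans[OF lip_v'[OF s] mult_left_mono[OF sol_lipschitz[OF s] M_nonneg]])
    then have "norm ((v' s (sol x s) - v' s (sol y s)) o\<^sub>L dsol x s) \<le> c"
      unfolding c_def using norm_dsol_le[OF s] M_nonneg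
      by (intro order_trans[OF norm_blinfun_compose mult_mono]) auto
    then show "norm ((v' s (sol x s) o\<^sub>L dsol x s) - (v' s (sol y s) o\<^sub>L dsol y s))
        \<le> L * norm (dsol x s - dsol y s) + c"
      unfolding eq using norm_v'_compose_le[OF s] by (intro norm_triangle_mono)
  qed (auto simp: c_def M_nonneg)
  then show ?thesis by (simp add: dsol c_def power3_eq_cube mult_ac)
qed

text \<open>The linearisation error \<open>r\<close> starts at 0 and satisfies the linearised
  equation up to the Taylor remainder of \<open>v s\<close>, which \<open>sol_lipschitz\<close>
  makes of second order in \<open>y - x\<close>. Gronwall preserves that order.\<close>

lemma sol_has_derivative:
  assumes t: "t \<in> {0..T}"
  shows "((\<lambda>x. sol x t) has_derivative blinfun_apply (dsol x t)) (at x)"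
proof (rule has_derivative_quadraticI)
  show "bounded_linear (dsol x t)" by (rule blinfun.bounded_linear_right)
  fix y
  define r where "r = (\<lambda>s. sol y s - sol x s - dsol x s (y - x))"
  define c where "c = M * (exp (L * T) * norm (y - x)) ^ 2"
  have "norm (r t) \<le> (norm (r 0) + c * T) * exp (L * T)"
  proof (rule gronwall_norm[OF _ _ L_nonneg _ t])
    fix s assume s: "s \<in> {0..T}"
    have "((\<lambda>s. dsol x s (y - x)) has_vector_derivative (v' s (sol x s) o\<^sub>L dsol x s) (y - x)) (at s within {0..T})"
      by (rule bounded_linear.has_vector_derivative[OF blinfun.bounded_linear_left dsol(2)[OF s]])
    then show "(r has_vector_derivative
        v s (sol y s) - v s (sol x s) - (v' s (sol x s) o\<^sub>L dsol x s) (y - x)) (at s within {0..T})"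
      unfolding r_def by (intro has_vector_derivative_diff sol s)
    have eq: "v s (sol y s) - v s (sol x s) - (v' s (sol x s) o\<^sub>L dsol x s) (y - x) =
       v' s (sol x s) (r s) + (v s (sol y s) - v s (sol x s) - v' s (sol x s) (sol y s - sol x s))"
      by (simp add: r_def blinfun.diff_right)
    have "norm (v s (sol y s) - v s (sol x s) - v' s (sol x s) (sol y s - sol x s))
        \<le> M * norm (sol y s - sol x s) ^ 2"
      using taylor_remainder_lipschitz[of "v s" "v' s" M] deriv_v[OF s] lip_v'[OF s] M_nonneg by blast
    also have "\<dots> \<le> c"
      unfolding c_def using sol_lipschitz[OF s] M_nonneg by (intro mult_left_mono power_mono) auto
    finally have 1: "norm (v s (sol y s) - v s (sol x s) - v' s (sol x s) (sol y s - sol x s)) \<le> c" .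
    have 2: "norm (v' s (sol x s) (r s)) \<le> L * norm (r s)"
      by (rule order_trans[OF norm_blinfun mult_right_mono]) (use bound_v'[OF s] in auto)
    show "norm (v s (sol y s) - v s (sol x s) - (v' s (sol x s) o\<^sub>L dsol x s) (y - x))
        \<le> L * norm (r s) + c"
      unfolding eq by (rule norm_triangle_mono[OF 2 1])
  qed (auto simp: c_def M_nonneg)
  then show "norm (sol y t - sol x t - dsol x t (y - x)) \<le> M * exp (L * T) ^ 3 * T * norm (y - x) ^ 2"
    by (simp add: r_def c_def sol dsol power_mult_distrib power2_eq_square power3_eq_cube mult_ac)
qed

lemma continuous_on_sol_prod:
  assumes "continuous_on S g" "continuous_on S y" "g ` S \<subseteq> {0..T}"
  shows "continuous_on S (\<lambda>p. sol (y p) (g p))"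
  using continuous_on_compose2[OF continuous_on_prod_lipschitz_snd[of UNIV "{0..T}" "\<lambda>t x. sol x t"
        "exp (L * T)", OF continuous_on_sol sol_lipschitz], of S "\<lambda>p. (g p, y p)"] assms
  by (auto intro!: continuous_on_Pair)

lemma continuous_on_dsol_prod:
  assumes "continuous_on S g" "continuous_on S y" "g ` S \<subseteq> {0..T}"
  shows "continuous_on S (\<lambda>p. dsol (y p) (g p))"
  using continuous_on_compose2[OF continuous_on_prod_lipschitz_snd[of UNIV "{0..T}" "\<lambda>t x. dsol x t"
        "M * exp (L * T) ^ 3 * T", OF continuous_on_dsol dsol_lipschitz], of S "\<lambda>p. (g p, y p)"] assms
  by (auto intro!: continuous_on_Pair)

end

text \<open>Restricting \<open>sol x\<close> to \<open>[0,t]\<close> gives existence and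
  \<open>sol_unique\<close> gives uniqueness of the end point, which together justify the definite
  description.\<close>

lemma flow_eq_sol:
  fixes v :: "real \<Rightarrow> real^'n \<Rightarrow> real^'n"
  assumes "smooth_field v v' T L M" and t: "t \<in> {0..T}"
  shows "flow v t x = smooth_field.sol v T x t"
proof -
  interpret smooth_field v v' T L M by fact
  show ?thesis
    unfolding flow_def
  proof (rule the_equality)
    show "\<exists>y. y 0 = x \<and> (\<forall>s\<in>{0..t}. (y has_vector_derivative v s (y s)) (at s within {0..t})) \<and> y t = sol x t"
      by (rule exI[of _ "sol x"])
        (use t in \<open>auto simp: sol(1) intro!: has_vector_derivative_within_subset[OF sol(2)]\<close>)
  qed (use sol_unique[OF t] in blast)
qed

section \<open>Currents and convolution\<close>

text \<open>A real supremum bounds its members only if they are bounded above. This is where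
  boundedness of the functionals enters: admissible test functions have sup norm at most 1.\<close>

lemma dist_w_upper:
  assumes cur: "is_current \<xi>" "is_current \<xi>'"
    and \<theta>: "L-lipschitz_on UNIV (apply_bcontfun \<theta>)" "norm \<theta> + L \<le> 1"
  shows "\<xi> \<theta> - \<xi>' \<theta> \<le> dist_w \<xi> \<xi>'"
  unfolding dist_w_def
proof (rule cSup_upper)
  have "bounded_linear (\<lambda>\<theta>. \<xi> \<theta> - \<xi>' \<theta>)"
    using cur unfolding is_current_def by (rule bounded_linear_sub)
  then obtain C where C: "C \<ge> 0" "\<And>\<theta>. norm (\<xi> \<theta> - \<xi>' \<theta>) \<le> norm \<theta> * C"
    using bounded_linear.nonneg_bounded by blast
  show "bdd_above {\<xi> \<theta> - \<xi>' \<theta> | \<theta>. \<exists>L. L-lipschitz_on UNIV (apply_bcontfun \<theta>) \<and> norm \<theta> + L \<le> 1}"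
  proof (rule bdd_aboveI, clarify)
    fix \<theta> :: "(real^'a) \<Rightarrow>\<^sub>C (real^'a)" and L
    assume "L-lipschitz_on UNIV (apply_bcontfun \<theta>)" "norm \<theta> + L \<le> 1"
    then have "norm \<theta> \<le> 1" using lipschitz_on_nonneg by fastforce
    then have "norm \<theta> * C \<le> 1 * C" using C(1) by (intro mult_right_mono)
    then show "\<xi> \<theta> - \<xi>' \<theta> \<le> C" using C(2)[of \<theta>] by simp
  qed
qed (use \<theta> in blast)

lemma dist_w_least:
  assumes "\<And>\<theta> L. L-lipschitz_on UNIV (apply_bcontfun \<theta>) \<Longrightarrow> norm \<theta> + L \<le> 1 \<Longrightarrow> \<xi> \<theta> - \<xi>' \<theta> \<le> c"
  shows "dist_w \<xi> \<xi>' \<le> c"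
  unfolding dist_w_def
proof (rule cSup_least)
  have "0-lipschitz_on UNIV (apply_bcontfun (0 :: (real^'a) \<Rightarrow>\<^sub>C (real^'a)))"
    by (rule lipschitz_onI) auto
  then show "{\<xi> \<theta> - \<xi>' \<theta> | \<theta>. \<exists>L. L-lipschitz_on UNIV (apply_bcontfun \<theta>) \<and> norm \<theta> + L \<le> 1} \<noteq> {}"
    using norm_zero[where 'a = "(real^'a) \<Rightarrow>\<^sub>C (real^'a)"] by (auto intro!: exI[of _ 0])
qed (use assms in blast)

lemma dist_w_nonneg:
  assumes "is_current \<xi>" "is_current \<xi>'"
  shows "0 \<le> dist_w \<xi> \<xi>'"
proof -
  have "0-lipschitz_on UNIV (apply_bcontfun (0 :: (real^'a) \<Rightarrow>\<^sub>C (real^'a)))"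
    by (rule lipschitz_onI) auto
  from dist_w_upper[OF assms this] show ?thesis
    using assms by (simp add: is_current_def linear_simps)
qed

lemma dist_w_triangle:
  assumes "is_current \<xi>" "is_current \<xi>'" "is_current \<xi>''"
  shows "dist_w \<xi> \<xi>'' \<le> dist_w \<xi> \<xi>' + dist_w \<xi>' \<xi>''"
  by (rule dist_w_least) (use dist_w_upper[OF assms(1,2)] dist_w_upper[OF assms(2,3)] in fastforce)

text \<open>Homogeneity: the test function is rescaled by \<open>norm \<theta> + L\<close>, which
  vanishes only for \<open>\<theta> = 0\<close>. As \<open>dist_w\<close> carries no absolute value,
  the two-sided bound comes from applying the one-sided one to \<open>- \<theta>\<close> as
  well.\<close>

lemma current_diff_le_dist_w:
  assumes cur: "is_current \<xi>" "is_current \<xi>'"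
    and lip: "L-lipschitz_on UNIV (apply_bcontfun \<theta>)"
  shows "\<bar>\<xi> \<theta> - \<xi>' \<theta>\<bar> \<le> dist_w \<xi> \<xi>' * (norm \<theta> + L)"
proof -
  have one: "\<xi> \<theta> - \<xi>' \<theta> \<le> dist_w \<xi> \<xi>' * (norm \<theta> + L)"
    if lip: "L-lipschitz_on UNIV (apply_bcontfun \<theta>)" for \<theta>
  proof (cases "norm \<theta> + L = 0")
    case True
    then have "\<theta> = 0" using lipschitz_on_nonneg[OF lip] norm_ge_zero[of \<theta>] by (metis add_nonneg_eq_0_iff norm_eq_zero)
    then show ?thesis using cur True by (simp add: is_current_def linear_simps)
  next
    case False
    define n where "n = norm \<theta> + L"
    have n: "n > 0" using False lipschitz_on_nonneg[OF lip] norm_ge_zero[of \<theta>] unfolding n_def by linarith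
    have "(L / n)-lipschitz_on UNIV (apply_bcontfun ((1 / n) *\<^sub>R \<theta>))"
      using lipschitz_on_cmult[OF lip, of "1 / n"] n by simp
    moreover have "norm ((1 / n) *\<^sub>R \<theta>) + L / n \<le> 1"
      using n by (simp add: n_def flip: add_divide_distrib)
    ultimately have "\<xi> ((1 / n) *\<^sub>R \<theta>) - \<xi>' ((1 / n) *\<^sub>R \<theta>) \<le> dist_w \<xi> \<xi>'"
      by (rule dist_w_upper[OF cur])
    then have "(\<xi> \<theta> - \<xi>' \<theta>) / n \<le> dist_w \<xi> \<xi>'"
      using cur by (simp add: is_current_def linear_simps diff_divide_distrib)
    then show ?thesis using n by (simp add: pos_divide_le_eq n_def)
  qed
  have "L-lipschitz_on UNIV (apply_bcontfun (- \<theta>))"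
    using lip by (auto simp: lipschitz_on_def dist_norm norm_minus_commute)
  from one[OF this] one[OF lip] show ?thesis
    using cur by (simp add: is_current_def linear_simps)
qed

text \<open>Measured from the zero current, \<open>dist_w\<close> is the dual bounded-Lipschitz
  norm; this is how that norm is expressed below.\<close>

lemma is_current_zero: "is_current (\<lambda>_. 0)"
  by (simp add: is_current_def bounded_linear_zero)

text \<open>Compactness of \<open>[0,T]\<close>: around each \<open>t\<close> the distance to
  \<open>\<xi> t\<close> is at most 1, finitely many such neighbourhoods cover, and the triangle
  inequality passes through their centres. The sum over the centres stands in for a maximum.\<close>

lemma cont_Mw_bounded:
  fixes \<xi> :: "real \<Rightarrow> ('n::finite) current"
  assumes "cont_Mw T \<xi>"
  obtains B where "\<And>s. s \<in> {0..T} \<Longrightarrow> dist_w (\<xi> s) (\<lambda>_. 0) \<le> B"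
proof -
  have cur: "is_current (\<xi> s)" if "s \<in> {0..T}" for s using assms that by (auto simp: cont_Mw_def)
  have "\<exists>d>0. \<forall>s\<in>{0..T}. dist s t < d \<longrightarrow> dist_w (\<xi> s) (\<xi> t) \<le> 1" if t: "t \<in> {0..T}" for t
  proof -
    have "((\<lambda>s. dist_w (\<xi> s) (\<xi> t)) \<longlongrightarrow> 0) (at t within {0..T})"
      using assms t by (auto simp: cont_Mw_def)
    from tendstoD[OF this zero_less_one] obtain d where d: "d > 0"
      "\<And>s. s \<in> {0..T} \<Longrightarrow> s \<noteq> t \<Longrightarrow> dist s t < d \<Longrightarrow> \<bar>dist_w (\<xi> s) (\<xi> t)\<bar> < 1"
      unfolding eventually_at by auto
    \<comment> \<open>The limit says nothing about \<open>s = t\<close>, so the centre is treated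
      separately.\<close>
    have "dist_w (\<xi> t) (\<xi> t) \<le> 1" by (rule dist_w_least) simp
    then show ?thesis using d by (metis abs_le_D1 less_imp_le)
  qed
  then obtain d where d: "\<And>t. t \<in> {0..T} \<Longrightarrow> d t > 0"
    "\<And>s t. s \<in> {0..T} \<Longrightarrow> t \<in> {0..T} \<Longrightarrow> dist s t < d t \<Longrightarrow> dist_w (\<xi> s) (\<xi> t) \<le> 1"
    by metis
  have "{0..T} \<subseteq> (\<Union>t\<in>{0..T}. ball t (d t))"
    using d(1) by (intro subsetI UN_I) auto
  then obtain D where D: "D \<subseteq> {0..T}" "finite D" "{0..T} \<subseteq> (\<Union>t\<in>D. ball t (d t))"
    by (rule compactE_image[OF compact_Icc, rotated]) auto
  show ?thesis
  proof
    fix s assume s: "s \<in> {0..T}"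
    then obtain t where t: "t \<in> D" "dist t s < d t" using D(3) by (auto simp: subset_iff)
    then have tT: "t \<in> {0..T}" using D(1) by auto
    have "dist_w (\<xi> s) (\<lambda>_. 0) \<le> dist_w (\<xi> s) (\<xi> t) + dist_w (\<xi> t) (\<lambda>_. 0)"
      by (intro dist_w_triangle cur s tT is_current_zero)
    moreover have "dist_w (\<xi> s) (\<xi> t) \<le> 1" using d(2)[OF s tT] t by (simp add: dist_commute)
    moreover have "dist_w (\<xi> t) (\<lambda>_. 0) \<le> (\<Sum>t\<in>D. dist_w (\<xi> t) (\<lambda>_. 0))"
      using D(1) t(1) by (intro member_le_sum D(2) dist_w_nonneg cur is_current_zero) auto
    ultimately show "dist_w (\<xi> s) (\<lambda>_. 0) \<le> 1 + (\<Sum>t\<in>D. dist_w (\<xi> t) (\<lambda>_. 0))" by linarith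
  qed
qed

section \<open>Convolution of a kernel with a current\<close>

lemma row_bcontfun:
  fixes F :: "real^'n \<Rightarrow> real^'n^'n"
  assumes "continuous_on UNIV F" and "\<And>z. norm (F z) \<le> a"
  shows "(\<lambda>y. F (x - y) $ i) \<in> bcontfun"
proof (rule bcontfun_normI)
  have "continuous_on UNIV (\<lambda>y. F (x - y))"
    by (rule continuous_on_compose2[OF assms(1)]) (auto intro!: continuous_intros)
  then show "continuous_on UNIV (\<lambda>y. F (x - y) $ i)"
    by (intro continuous_intros)
  show "norm (F (x - y) $ i) \<le> a" for y
    using Finite_Cartesian_Product.norm_nth_le[of "F (x - y)" i] assms(2)[of "x - y"] by linarith
qed

text \<open>One law for several uses: \<open>c = 1\<close> gives additivity, \<open>c = - 1\<close>
  subtraction, and a second kernel whose convolution vanishes gives homogeneity. The hypotheses on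
  the kernels make every \<open>Bcontfun\<close> involved meaningful.\<close>

lemma conv_lincomb:
  fixes F G :: "real^'n \<Rightarrow> real^'n^'n"
  assumes "is_current \<xi>"
    and "continuous_on UNIV F" "\<And>z. norm (F z) \<le> a"
    and "continuous_on UNIV G" "\<And>z. norm (G z) \<le> b"
  shows "conv (\<lambda>z. c *\<^sub>R F z + G z) \<xi> x = c *\<^sub>R conv F \<xi> x + conv G \<xi> x"
proof -
  have "\<xi> (Bcontfun (\<lambda>y. (c *\<^sub>R F (x - y) + G (x - y)) $ i)) =
      c * \<xi> (Bcontfun (\<lambda>y. F (x - y) $ i)) + \<xi> (Bcontfun (\<lambda>y. G (x - y) $ i))" for i
  proof -
    have f: "(\<lambda>y. F (x - y) $ i) \<in> bcontfun" and g: "(\<lambda>y. G (x - y) $ i) \<in> bcontfun"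
      using row_bcontfun assms by blast+
    have h: "(\<lambda>y. c *\<^sub>R F (x - y) $ i + G (x - y) $ i) \<in> bcontfun"
      by (intro plus_cont scaleR_cont f g)
    have "Bcontfun (\<lambda>y. (c *\<^sub>R F (x - y) + G (x - y)) $ i) =
       c *\<^sub>R Bcontfun (\<lambda>y. F (x - y) $ i) + Bcontfun (\<lambda>y. G (x - y) $ i)"
      by (rule bcontfun_eqI) (simp add: Bcontfun_inverse[OF f] Bcontfun_inverse[OF g] Bcontfun_inverse[OF h])
    then show ?thesis using assms(1) by (simp add: is_current_def linear_simps)
  qed
  then show ?thesis by (simp add: conv_def vec_eq_iff)
qed

lemma conv_diff:
  fixes F G :: "real^'n \<Rightarrow> real^'n^'n"
  assumes "is_current \<xi>"
    and "continuous_on UNIV F" "\<And>z. norm (F z) \<le> a"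
    and "continuous_on UNIV G" "\<And>z. norm (G z) \<le> b"
  shows "conv (\<lambda>z. F z - G z) \<xi> x = conv F \<xi> x - conv G \<xi> x"
  using conv_lincomb[OF assms(1,4,5,2,3), of "- 1" x] by simp

text \<open>Origin of the factor \<open>CARD('n)\<close>: the Euclidean norm is bounded by the sum
  of the absolute components. The functional is arbitrary, so differences of currents are
  covered.\<close>

lemma norm_conv_le:
  fixes F :: "real^'n \<Rightarrow> real^'n^'n"
  assumes "\<And>i. \<bar>\<xi> (Bcontfun (\<lambda>y. F (x - y) $ i))\<bar> \<le> c"
  shows "norm (conv F \<xi> x) \<le> real CARD('n) * c"
proof -
  have "norm (conv F \<xi> x) \<le> (\<Sum>i\<in>(UNIV :: 'n set). \<bar>conv F \<xi> x $ i\<bar>)" by (rule norm_le_l1_cart)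
  also have "\<dots> \<le> (\<Sum>i\<in>(UNIV :: 'n set). c)" using assms by (intro sum_mono) (simp add: conv_def)
  finally show ?thesis by simp
qed

text \<open>For a single current the operator norm controls the field by the sup of the kernel
  alone, with \<open>C\<close> independent of kernel and point. This is used at a fixed time to
  differentiate in space.\<close>

lemma conv_sup_bound:
  fixes \<xi> :: "'n::finite current"
  assumes "is_current \<xi>"
  obtains C where "\<And>F a x. continuous_on UNIV F \<Longrightarrow> (\<And>z. norm (F z) \<le> a) \<Longrightarrow> norm (conv F \<xi> x) \<le> C * a"
proof -
  obtain B where B: "B \<ge> 0" "\<And>\<theta>. norm (\<xi> \<theta>) \<le> norm \<theta> * B"
    using assms bounded_linear.nonneg_bounded unfolding is_current_def by blast
  show ?thesis
  proof
    fix F :: "real^'n \<Rightarrow> real^'n^'n" and a x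
    assume F: "continuous_on UNIV F" "\<And>z. norm (F z) \<le> a"
    have "\<bar>\<xi> (Bcontfun (\<lambda>y. F (x - y) $ i))\<bar> \<le> a * B" for i
    proof -
      have "norm (Bcontfun (\<lambda>y. F (x - y) $ i)) \<le> a"
        by (rule norm_bound) (auto simp: Bcontfun_inverse[OF row_bcontfun[OF F]] intro: order_trans[OF Finite_Cartesian_Product.norm_nth_le F(2)])
      then show ?thesis using B(2)[of "Bcontfun (\<lambda>y. F (x - y) $ i)"] B(1)
        by (smt (verit) mult_right_mono real_norm_def)
    qed
    then have "norm (conv F \<xi> x) \<le> real CARD('n) * (a * B)" by (rule norm_conv_le)
    then show "norm (conv F \<xi> x) \<le> (real CARD('n) * B) * a" by (simp add: mult_ac)
  qed
qed

text \<open>Reflection and translation preserve sup bounds and Lipschitz constants, so each row of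
  \<open>F (x - y)\<close>, as a function of \<open>y\<close>, is a test function of size at most
  \<open>a + b\<close>, uniformly in \<open>x\<close>.\<close>

lemma conv_dist_w:
  fixes F :: "real^'n \<Rightarrow> real^'n^'n"
  assumes cur: "is_current \<xi>" "is_current \<xi>'"
    and F: "\<And>z. norm (F z) \<le> a" "\<And>z w. norm (F z - F w) \<le> b * norm (z - w)" "0 \<le> b"
  shows "norm (conv F \<xi> x - conv F \<xi>' x) \<le> real CARD('n) * dist_w \<xi> \<xi>' * (a + b)"
proof -
  have "b-lipschitz_on UNIV F" using F by (auto intro!: lipschitz_onI simp: dist_norm)
  then have cont: "continuous_on UNIV F" by (rule lipschitz_on_continuous_on)
  have "\<bar>\<xi> (Bcontfun (\<lambda>y. F (x - y) $ i)) - \<xi>' (Bcontfun (\<lambda>y. F (x - y) $ i))\<bar> \<le> dist_w \<xi> \<xi>' * (a + b)" for i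
  proof -
    let ?\<theta> = "Bcontfun (\<lambda>y. F (x - y) $ i)"
    have app: "apply_bcontfun ?\<theta> = (\<lambda>y. F (x - y) $ i)"
      by (rule Bcontfun_inverse[OF row_bcontfun[OF cont F(1)]])
    have n: "norm ?\<theta> \<le> a"
      by (rule norm_bound) (auto simp: app intro: order_trans[OF Finite_Cartesian_Product.norm_nth_le F(1)])
    have "b-lipschitz_on UNIV (apply_bcontfun ?\<theta>)"
    proof (rule lipschitz_onI)
      fix y w :: "real^'n"
      have "norm (F (x - y) $ i - F (x - w) $ i) \<le> norm (F (x - y) - F (x - w))"
        using Finite_Cartesian_Product.norm_nth_le[of "F (x - y) - F (x - w)" i] by simp
      also have "\<dots> \<le> b * norm ((x - y) - (x - w))" by (rule F)
      finally show "dist (apply_bcontfun ?\<theta> y) (apply_bcontfun ?\<theta> w) \<le> b * dist y w"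
        by (simp add: app dist_norm norm_minus_commute)
    qed (rule F)
    from current_diff_le_dist_w[OF cur this]
    show ?thesis using mult_left_mono[of "norm ?\<theta> + b" "a + b", OF _ dist_w_nonneg[OF cur]] n by linarith
  qed
  then have "norm (conv F (\<lambda>\<theta>. \<xi> \<theta> - \<xi>' \<theta>) x) \<le> real CARD('n) * (dist_w \<xi> \<xi>' * (a + b))"
    by (rule norm_conv_le)
  moreover have "conv F (\<lambda>\<theta>. \<xi> \<theta> - \<xi>' \<theta>) x = conv F \<xi> x - conv F \<xi>' x"
    by (simp add: conv_def vec_eq_iff)
  ultimately show ?thesis by (simp add: mult.assoc)
qed

text \<open>
  The norms of \<open>\<xi> s\<close> in the dual of \<open>C\<^sub>b\<close> need not be bounded in \<open>s\<close>; only the dual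
  bounded-Lipschitz norms are. A uniform Lipschitz constant for the derivative of the field
  therefore costs one more derivative of \<open>K\<close>, which is where the bound on \<open>D\<^sup>3 K\<close> enters.
\<close>

lemma smooth_field_conv:
  fixes K :: "real^'n \<Rightarrow> real^'n^'n" and \<xi> :: "real \<Rightarrow> 'n current"
  assumes "UCb3 K" and cont: "cont_Mw T \<xi>" and T: "0 \<le> T"
  obtains v' L M where "smooth_field (\<lambda>s. conv K (\<xi> s)) v' T L M"
proof -
  obtain K1 K2 K3 where
    dK: "\<And>x. (K has_derivative blinfun_apply (K1 x)) (at x)" and
    dK1: "\<And>x. (K1 has_derivative blinfun_apply (K2 x)) (at x)" and
    dK2: "\<And>x. (K2 has_derivative blinfun_apply (K3 x)) (at x)" and
    bd: "bounded (range K)" "bounded (range K1)" "bounded (range K2)" "bounded (range K3)"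
    using \<open>UCb3 K\<close> unfolding UCb3_def by blast
  obtain M0 M1 M2 M3 where b: "\<And>x. norm (K x) \<le> M0" "\<And>x. norm (K1 x) \<le> M1"
    "\<And>x. norm (K2 x) \<le> M2" "\<And>x. norm (K3 x) \<le> M3"
    using bd unfolding bounded_iff by auto
  have nonneg: "0 \<le> M1" "0 \<le> M2" "0 \<le> M3"
    using b(2-4)[of 0] order_trans[OF norm_ge_zero] by blast+
  have lipK: "norm (K x - K y) \<le> M1 * norm (x - y)" for x y
    by (rule lipschitz_of_blinfun_derivative[OF dK b(2)])
  have lipK1: "norm (K1 x - K1 y) \<le> M2 * norm (x - y)" for x y
    by (rule lipschitz_of_blinfun_derivative[OF dK1 b(3)])
  have lipK2: "norm (K2 x - K2 y) \<le> M3 * norm (x - y)" for x y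
    by (rule lipschitz_of_blinfun_derivative[OF dK2 b(4)])
  have cK: "continuous_on UNIV K"
    using dK by (meson differentiableI differentiable_imp_continuous_on differentiable_on_def differentiable_at_withinI)
  have cK1: "continuous_on UNIV K1"
    using dK1 by (meson differentiableI differentiable_imp_continuous_on differentiable_on_def differentiable_at_withinI)
  have cKx: "continuous_on UNIV (\<lambda>z. K (z + x))" for x
    by (rule continuous_on_compose2[OF cK]) (auto intro!: continuous_intros)
  have cK1x: "continuous_on UNIV (\<lambda>z. K1 (z + x) h)" for x h
    by (intro bounded_linear.continuous_on[OF blinfun.bounded_linear_left]
        continuous_on_compose2[OF cK1]) (auto intro!: continuous_intros)
  have cK1h: "continuous_on UNIV (\<lambda>z. K1 z h)" for h using cK1x[of 0 h] by simp
  have bK1h: "norm (K1 z h) \<le> M1 * norm h" for z h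
    by (rule order_trans[OF norm_blinfun mult_right_mono[OF b(2)]]) simp
  have lipK1h: "norm (K1 z h - K1 w h) \<le> (M2 * norm h) * norm (z - w)" for z w h
  proof -
    have "norm ((K1 z - K1 w) h) \<le> (M2 * norm (z - w)) * norm h"
      by (rule order_trans[OF norm_blinfun mult_right_mono[OF lipK1]]) simp
    then show ?thesis by (simp add: blinfun.diff_left mult_ac)
  qed
  have cur: "is_current (\<xi> s)" if "s \<in> {0..T}" for s
    using cont that by (auto simp: cont_Mw_def)
  obtain B0 where B0: "\<And>s. s \<in> {0..T} \<Longrightarrow> dist_w (\<xi> s) (\<lambda>_. 0) \<le> B0"
    using cont_Mw_bounded[OF cont] by blast
  define B where "B = real CARD('n) * B0"
  have "0 \<le> B0" using order_trans[OF dist_w_nonneg[OF cur is_current_zero] B0, of 0] T by simp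
  then have B: "0 \<le> B" by (simp add: B_def)
  have BL: "norm (conv F (\<xi> s) x) \<le> B * (a + b)"
    if s: "s \<in> {0..T}" and F: "\<And>z. norm (F z) \<le> a" "\<And>z w. norm (F z - F w) \<le> b * norm (z - w)" "0 \<le> b"
    for F s a b x
  proof -
    have "0 \<le> a" using order_trans[OF norm_ge_zero F(1)] .
    have "norm (conv F (\<xi> s) x - conv F (\<lambda>_. 0) x) \<le> real CARD('n) * dist_w (\<xi> s) (\<lambda>_. 0) * (a + b)"
      by (rule conv_dist_w[OF cur[OF s] is_current_zero F])
    also have "\<dots> \<le> B * (a + b)"
      unfolding B_def using B0[OF s] \<open>0 \<le> a\<close> \<open>0 \<le> b\<close> by (intro mult_right_mono mult_left_mono) auto
    also have "conv F (\<lambda>_. 0) x = 0" by (simp add: conv_def vec_eq_iff)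
    finally show ?thesis by simp
  qed
  \<comment> \<open>The derivative falls on the kernel: in direction \<open>h\<close> it is the
    convolution with \<open>K1 z h\<close>. \<open>Blinfun\<close> has its intended value only once
    bounded linearity in \<open>h\<close> is proved.\<close>
  define v' where "v' = (\<lambda>s x. Blinfun (\<lambda>h. conv (\<lambda>z. K1 z h) (\<xi> s) x))"
  have v'b: "norm (conv (\<lambda>z. K1 z h) (\<xi> s) x) \<le> B * (M1 + M2) * norm h" if s: "s \<in> {0..T}" for s x h
    using BL[OF s, of "\<lambda>z. K1 z h" "M1 * norm h" "M2 * norm h" x, OF bK1h lipK1h] nonneg
    by (simp add: algebra_simps)
  have v': "blinfun_apply (v' s x) h = conv (\<lambda>z. K1 z h) (\<xi> s) x" if s: "s \<in> {0..T}" for s x h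
  proof -
    have lin: "conv (\<lambda>z. c *\<^sub>R K1 z g + K1 z h) (\<xi> s) x =
        c *\<^sub>R conv (\<lambda>z. K1 z g) (\<xi> s) x + conv (\<lambda>z. K1 z h) (\<xi> s) x" for c g h
      by (rule conv_lincomb[OF cur[OF s] cK1h bK1h cK1h bK1h])
    have zero: "conv (\<lambda>z. K1 z 0) (\<xi> s) x = 0" using v'b[OF s, of 0 x] by simp
    have "bounded_linear (\<lambda>h. conv (\<lambda>z. K1 z h) (\<xi> s) x)"
    proof (rule bounded_linear_intro)
      show "norm (conv (\<lambda>z. K1 z h) (\<xi> s) x) \<le> norm h * (B * (M1 + M2))" for h
        using v'b[OF s] by (simp add: mult.commute)
      show "conv (\<lambda>z. K1 z (g + h)) (\<xi> s) x = conv (\<lambda>z. K1 z g) (\<xi> s) x + conv (\<lambda>z. K1 z h) (\<xi> s) x" for g h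
        using lin[of 1 g h] by (simp add: blinfun.add_right)
      show "conv (\<lambda>z. K1 z (c *\<^sub>R h)) (\<xi> s) x = c *\<^sub>R conv (\<lambda>z. K1 z h) (\<xi> s) x" for c h
        using lin[of c h 0] zero by (simp add: blinfun.scaleR_right)
    qed
    then show ?thesis by (simp add: v'_def bounded_linear_Blinfun_apply)
  qed
  have lim: "((\<lambda>s. C * dist_w (\<xi> s) (\<xi> t)) \<longlongrightarrow> 0) (at t within {0..T})" if "t \<in> {0..T}" for t C
    using cont that unfolding cont_Mw_def by (auto intro: tendsto_mult_right_zero)
  have "smooth_field (\<lambda>s. conv K (\<xi> s)) v' T (B * (M1 + M2)) (B * (M2 + M3))"
  proof
    show "0 \<le> T" by (rule T)
    show "0 \<le> B * (M2 + M3)" using B nonneg by simp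
  next
    fix x
    show "continuous_on {0..T} (\<lambda>s. conv K (\<xi> s) x)"
      unfolding continuous_on_def
    proof
      fix t assume t: "t \<in> {0..T}"
      show "((\<lambda>s. conv K (\<xi> s) x) \<longlongrightarrow> conv K (\<xi> t) x) (at t within {0..T})"
      proof (subst Lim_null, rule Lim_null_comparison[OF _ lim[OF t, of "real CARD('n) * (M0 + M1)"]])
        show "\<forall>\<^sub>F s in at t within {0..T}. norm (conv K (\<xi> s) x - conv K (\<xi> t) x)
            \<le> real CARD('n) * (M0 + M1) * dist_w (\<xi> s) (\<xi> t)"
          unfolding eventually_at_filter
          using conv_dist_w[OF cur cur[OF t] b(1) lipK nonneg(1)]
          by (intro always_eventually) (auto simp: mult_ac)
      qed
    qed
    show "continuous_on {0..T} (\<lambda>s. v' s x)"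
      unfolding continuous_on_def
    proof
      fix t assume t: "t \<in> {0..T}"
      have bnd: "norm (v' s x - v' t x) \<le> real CARD('n) * (M1 + M2) * dist_w (\<xi> s) (\<xi> t)"
        if s: "s \<in> {0..T}" for s
      proof (rule norm_blinfun_bound)
        show "0 \<le> real CARD('n) * (M1 + M2) * dist_w (\<xi> s) (\<xi> t)"
          using nonneg dist_w_nonneg[OF cur[OF s] cur[OF t]] by simp
        fix h
        have "norm (conv (\<lambda>z. K1 z h) (\<xi> s) x - conv (\<lambda>z. K1 z h) (\<xi> t) x)
            \<le> real CARD('n) * dist_w (\<xi> s) (\<xi> t) * (M1 * norm h + M2 * norm h)"
          by (rule conv_dist_w[OF cur[OF s] cur[OF t] bK1h lipK1h]) (use nonneg in auto)
        then show "norm ((v' s x - v' t x) h) \<le> real CARD('n) * (M1 + M2) * dist_w (\<xi> s) (\<xi> t) * norm h"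
          unfolding blinfun.diff_left v'[OF s] v'[OF t] by (simp add: algebra_simps)
      qed
      show "((\<lambda>s. v' s x) \<longlongrightarrow> v' t x) (at t within {0..T})"
        by (subst Lim_null, rule Lim_null_comparison[OF _ lim[OF t, of "real CARD('n) * (M1 + M2)"]])
          (use bnd in \<open>auto simp: eventually_at_filter intro!: always_eventually\<close>)
    qed
  next
    fix s x assume s: "s \<in> {0..T}"
    \<comment> \<open>\<open>C\<close> may depend on \<open>s\<close>: differentiability concerns
      one time only, whereas the two norm bounds that follow have to be uniform in time and
      therefore rely on \<open>BL\<close>.\<close>
    obtain C where C: "\<And>F a x. continuous_on UNIV F \<Longrightarrow> (\<And>z. norm (F z) \<le> a) \<Longrightarrow> norm (conv F (\<xi> s) x) \<le> C * a"
      using conv_sup_bound[OF cur[OF s]] by metis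
    show "(conv K (\<xi> s) has_derivative blinfun_apply (v' s x)) (at x)"
    proof (rule has_derivative_quadraticI[OF blinfun.bounded_linear_right])
      fix y
      let ?h = "y - x"
      have bd: "norm (K (z + y) - K (z + x)) \<le> M0 + M0" for z
        by (rule order_trans[OF norm_triangle_ineq4 add_mono[OF b(1) b(1)]])
      have cd: "continuous_on UNIV (\<lambda>z. K (z + y) - K (z + x))"
        by (intro continuous_intros cKx)
      \<comment> \<open>Convolutions at different points cannot be merged directly. Translating the
        kernels by \<open>x\<close> and \<open>y\<close> turns each term into a convolution at 0,
        where \<open>conv_diff\<close> applies.\<close>
      have "conv K (\<xi> s) y - conv K (\<xi> s) x - v' s x ?h =
          conv (\<lambda>z. K (z + y)) (\<xi> s) 0 - conv (\<lambda>z. K (z + x)) (\<xi> s) 0 - conv (\<lambda>z. K1 (z + x) ?h) (\<xi> s) 0"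
        unfolding v'[OF s] by (simp add: conv_def)
      also have "\<dots> = conv (\<lambda>z. K (z + y) - K (z + x) - K1 (z + x) ?h) (\<xi> s) 0"
        by (simp add: conv_diff[OF cur[OF s] cd bd cK1x bK1h]
            conv_diff[OF cur[OF s] cKx b(1) cKx b(1)])
      finally have eq: "conv K (\<xi> s) y - conv K (\<xi> s) x - v' s x ?h =
          conv (\<lambda>z. K (z + y) - K (z + x) - K1 (z + x) ?h) (\<xi> s) 0" .
      have "norm (conv (\<lambda>z. K (z + y) - K (z + x) - K1 (z + x) ?h) (\<xi> s) 0) \<le> C * (M2 * norm ?h ^ 2)"
      proof (rule C)
        show "continuous_on UNIV (\<lambda>z. K (z + y) - K (z + x) - K1 (z + x) ?h)"
          by (intro continuous_on_diff cd cK1x)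
        show "norm (K (z + y) - K (z + x) - K1 (z + x) ?h) \<le> M2 * norm ?h ^ 2" for z
          using taylor_remainder_lipschitz[of K K1 M2 "z + y" "z + x", OF dK lipK1 nonneg(2)] by simp
      qed
      then show "norm (conv K (\<xi> s) y - conv K (\<xi> s) x - v' s x ?h) \<le> (C * M2) * norm ?h ^ 2"
        unfolding eq by (simp add: mult.assoc)
    qed
    show "norm (v' s x) \<le> B * (M1 + M2)"
      by (rule norm_blinfun_bound) (use v'b[OF s] B nonneg in \<open>auto simp: v'[OF s]\<close>)
    fix y
    show "norm (v' s x - v' s y) \<le> B * (M2 + M3) * norm (x - y)"
    proof (rule norm_blinfun_bound)
      show "0 \<le> B * (M2 + M3) * norm (x - y)" using B nonneg by simp
      fix h
      have "(v' s x - v' s y) h = conv (\<lambda>z. K1 (z + x) h) (\<xi> s) 0 - conv (\<lambda>z. K1 (z + y) h) (\<xi> s) 0"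
        unfolding blinfun.diff_left v'[OF s] by (simp add: conv_def)
      also have "\<dots> = conv (\<lambda>z. K1 (z + x) h - K1 (z + y) h) (\<xi> s) 0"
        by (rule conv_diff[OF cur[OF s] cK1x bK1h cK1x bK1h, symmetric])
      finally have eq: "(v' s x - v' s y) h = conv (\<lambda>z. K1 (z + x) h - K1 (z + y) h) (\<xi> s) 0" .
      \<comment> \<open>The difference of two translates has \<open>z\<close>-derivative
        \<open>K2 (z + x) - K2 (z + y)\<close>, so its Lipschitz constant is itself proportional to
        \<open>norm (x - y)\<close>.\<close>
      have lip: "norm ((K1 (z + x) - K1 (z + y)) - (K1 (w + x) - K1 (w + y))) \<le> (M3 * norm (x - y)) * norm (z - w)" for z w
      proof (rule lipschitz_of_blinfun_derivative[where f' = "\<lambda>z. K2 (z + x) - K2 (z + y)"])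
        fix z
        have sh: "((\<lambda>z. K1 (z + u)) has_derivative K2 (z + u)) (at z)" for u
          by (rule has_derivative_compose[of "\<lambda>z. z + u" "\<lambda>h. h" z UNIV K1, OF _ dK1])
            (auto intro!: derivative_eq_intros)
        show "((\<lambda>z. K1 (z + x) - K1 (z + y)) has_derivative (K2 (z + x) - K2 (z + y))) (at z)"
          using has_derivative_diff[OF sh[of x] sh[of y]] by (simp add: minus_blinfun.rep_eq fun_diff_def)
        show "norm (K2 (z + x) - K2 (z + y)) \<le> M3 * norm (x - y)"
          using lipK2[of "z + x" "z + y"] by simp
      qed
      have "norm (conv (\<lambda>z. K1 (z + x) h - K1 (z + y) h) (\<xi> s) 0)
          \<le> B * (M2 * norm h * norm (x - y) + M3 * norm (x - y) * norm h)"
      proof (rule BL[OF s])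
        show "norm (K1 (z + x) h - K1 (z + y) h) \<le> M2 * norm h * norm (x - y)" for z
          using lipK1h[of "z + x" h "z + y"] by simp
        show "0 \<le> M3 * norm (x - y) * norm h" using nonneg by simp
        fix z w
        have "norm (((K1 (z + x) - K1 (z + y)) - (K1 (w + x) - K1 (w + y))) h) \<le> ((M3 * norm (x - y)) * norm (z - w)) * norm h"
          by (rule order_trans[OF norm_blinfun mult_right_mono[OF lip]]) simp
        then show "norm (K1 (z + x) h - K1 (z + y) h - (K1 (w + x) h - K1 (w + y) h))
            \<le> M3 * norm (x - y) * norm h * norm (z - w)"
          by (simp add: blinfun.diff_left mult_ac)
      qed
      then show "norm ((v' s x - v' s y) h) \<le> B * (M2 + M3) * norm (x - y) * norm h"
        unfolding eq by (simp add: algebra_simps)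
    qed
  qed
  then show ?thesis by (rule that)
qed

section \<open>Currents carried by curves\<close>

text \<open>\<open>C1_curve\<close> with its witness exposed, so that tangents can be transported
  and integrated by name and not through \<open>vector_derivative\<close>.\<close>

definition curve_deriv :: "(real \<Rightarrow> real^'n) \<Rightarrow> (real \<Rightarrow> real^'n) \<Rightarrow> bool" where
  "curve_deriv c g \<longleftrightarrow> continuous_on {0..1} g \<and>
     (\<forall>\<sigma>\<in>{0..1}. (c has_vector_derivative g \<sigma>) (at \<sigma> within {0..1}))"

lemma curve_deriv_continuous: "curve_deriv c g \<Longrightarrow> continuous_on {0..1} c"
  unfolding curve_deriv_def by (auto intro: continuous_on_vector_derivative)

lemma curve_deriv_vector_derivative:
  "curve_deriv c g \<Longrightarrow> \<sigma> \<in> {0..1} \<Longrightarrow> vector_derivative c (at \<sigma> within {0..1}) = g \<sigma>"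
  unfolding curve_deriv_def using vector_derivative_within_cbox[of 0 1 \<sigma> c "g \<sigma>"] by auto

lemma curve_current_eq:
  assumes "\<And>j. j \<in> {1..N} \<Longrightarrow> curve_deriv (c j) (g j)"
  shows "curve_current \<alpha> N c \<theta> = (\<Sum>j=1..N. \<alpha> j * integral {0..1} (\<lambda>\<sigma>. \<theta> (c j \<sigma>) \<bullet> g j \<sigma>))"
  unfolding curve_current_def
  by (intro sum.cong refl arg_cong2[where f = "(*)"] integral_cong)
    (simp add: curve_deriv_vector_derivative[OF assms])

lemma curve_deriv_cong:
  assumes "curve_deriv c g" "\<And>\<sigma>. \<sigma> \<in> {0..1} \<Longrightarrow> c \<sigma> = d \<sigma>"
  shows "curve_deriv d g"
  using assms unfolding curve_deriv_def
  by (auto intro: has_vector_derivative_transform[where f = c])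

lemma curve_current_cong:
  fixes c d :: "nat \<Rightarrow> real \<Rightarrow> real^'n"
  assumes c: "\<And>j. j \<in> {1..N} \<Longrightarrow> curve_deriv (c j) (g j)"
    and eq: "\<And>j \<sigma>. j \<in> {1..N} \<Longrightarrow> \<sigma> \<in> {0..1} \<Longrightarrow> c j \<sigma> = d j \<sigma>"
  shows "curve_current \<alpha> N c = curve_current \<alpha> N d"
proof
  fix \<theta> :: "(real^'n) \<Rightarrow>\<^sub>C (real^'n)"
  have d: "curve_deriv (d j) (g j)" if "j \<in> {1..N}" for j
    using curve_deriv_cong[OF c[OF that] eq[OF that]] .
  have "integral {0..1} (\<lambda>\<sigma>. \<theta> (c j \<sigma>) \<bullet> g j \<sigma>) = integral {0..1} (\<lambda>\<sigma>. \<theta> (d j \<sigma>) \<bullet> g j \<sigma>)"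
    if "j \<in> {1..N}" for j
    by (rule integral_cong) (simp add: eq[OF that])
  then show "curve_current \<alpha> N c \<theta> = curve_current \<alpha> N d \<theta>"
    using curve_current_eq[of N c g \<alpha> \<theta>, OF c] curve_current_eq[of N d g \<alpha> \<theta>, OF d] by simp
qed

lemma continuous_on_test_along_curve:
  assumes "curve_deriv c g"
  shows "continuous_on {0..1} (\<lambda>\<sigma>. apply_bcontfun \<theta> (c \<sigma>) \<bullet> g \<sigma>)"
proof -
  have "continuous_on {0..1} (\<lambda>\<sigma>. apply_bcontfun \<theta> (c \<sigma>))"
    by (rule continuous_on_compose2[of UNIV "apply_bcontfun \<theta>"])
      (auto intro: curve_deriv_continuous[OF assms])
  then show ?thesis using assms by (auto simp: curve_deriv_def intro!: continuous_intros)
qed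

text \<open>Each curve contributes a functional bounded by its length, the integral of
  \<open>norm (g j \<sigma>)\<close>.\<close>

lemma is_current_curve_current:
  assumes c: "\<And>j. j \<in> {1..N} \<Longrightarrow> curve_deriv (c j) (g j)"
  shows "is_current (curve_current \<alpha> N c)"
proof -
  have "bounded_linear (\<lambda>\<theta> :: (real^'a) \<Rightarrow>\<^sub>C (real^'a). integral {0..1} (\<lambda>\<sigma>. \<theta> (c j \<sigma>) \<bullet> g j \<sigma>))"
    if j: "j \<in> {1..N}" for j
  proof (rule bounded_linear_intro)
    fix \<theta> \<eta> :: "(real^'a) \<Rightarrow>\<^sub>C (real^'a)" and r :: real
    have int: "(\<lambda>\<sigma>. apply_bcontfun \<theta> (c j \<sigma>) \<bullet> g j \<sigma>) integrable_on {0..1}" for \<theta>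
      by (intro integrable_continuous_real continuous_on_test_along_curve c j)
    show "integral {0..1} (\<lambda>\<sigma>. (\<theta> + \<eta>) (c j \<sigma>) \<bullet> g j \<sigma>) =
      integral {0..1} (\<lambda>\<sigma>. \<theta> (c j \<sigma>) \<bullet> g j \<sigma>) + integral {0..1} (\<lambda>\<sigma>. \<eta> (c j \<sigma>) \<bullet> g j \<sigma>)"
      by (simp add: inner_add_left integral_add[OF int int])
    show "integral {0..1} (\<lambda>\<sigma>. (r *\<^sub>R \<theta>) (c j \<sigma>) \<bullet> g j \<sigma>) =
      r *\<^sub>R integral {0..1} (\<lambda>\<sigma>. \<theta> (c j \<sigma>) \<bullet> g j \<sigma>)"
      by simp
    have gi: "(\<lambda>\<sigma>. norm (g j \<sigma>)) integrable_on {0..1}"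
      using c[OF j] by (intro integrable_continuous_real continuous_intros) (auto simp: curve_deriv_def)
    have "norm (integral {0..1} (\<lambda>\<sigma>. \<theta> (c j \<sigma>) \<bullet> g j \<sigma>)) \<le> integral {0..1} (\<lambda>\<sigma>. norm \<theta> * norm (g j \<sigma>))"
    proof (rule Henstock_Kurzweil_Integration.integral_norm_bound_integral[OF int])
      show "(\<lambda>\<sigma>. norm \<theta> * norm (g j \<sigma>)) integrable_on {0..1}"
        using gi by (rule integrable_on_cmult_left[where 'b = real, simplified])
      show "norm (\<theta> (c j \<sigma>) \<bullet> g j \<sigma>) \<le> norm \<theta> * norm (g j \<sigma>)" for \<sigma>
        using Cauchy_Schwarz_ineq2[of "\<theta> (c j \<sigma>)" "g j \<sigma>"]
          mult_right_mono[OF norm_bounded[of \<theta> "c j \<sigma>"] norm_ge_zero[of "g j \<sigma>"]] by simp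
    qed
    then show "norm (integral {0..1} (\<lambda>\<sigma>. \<theta> (c j \<sigma>) \<bullet> g j \<sigma>)) \<le>
      norm \<theta> * integral {0..1} (\<lambda>\<sigma>. norm (g j \<sigma>))"
      by simp
  qed
  then have "bounded_linear (\<lambda>\<theta>. \<Sum>j=1..N. \<alpha> j * integral {0..1} (\<lambda>\<sigma>. apply_bcontfun \<theta> (c j \<sigma>) \<bullet> g j \<sigma>))"
    by (intro bounded_linear_sum bounded_linear_const_mult)
  moreover have "curve_current \<alpha> N c =
      (\<lambda>\<theta>. \<Sum>j=1..N. \<alpha> j * integral {0..1} (\<lambda>\<sigma>. apply_bcontfun \<theta> (c j \<sigma>) \<bullet> g j \<sigma>))"
    by (rule ext) (rule curve_current_eq[OF c])
  ultimately show ?thesis by (simp add: is_current_def)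
qed

text \<open>Pairing row \<open>i\<close> of the kernel with the tangent gives component
  \<open>i\<close> of the matrix-vector product, and integration commutes with taking components
  once the product is integrable.\<close>

lemma conv_curve_current:
  fixes K :: "real^'n \<Rightarrow> real^'n^'n"
  assumes K: "continuous_on UNIV K" "\<And>z. norm (K z) \<le> a"
    and c: "\<And>j. j \<in> {1..N} \<Longrightarrow> curve_deriv (c j) (g j)"
  shows "conv K (curve_current \<alpha> N c) x =
    (\<Sum>j=1..N. \<alpha> j *\<^sub>R integral {0..1} (\<lambda>\<sigma>. K (x - c j \<sigma>) *v vector_derivative (c j) (at \<sigma> within {0..1})))"
proof -
  have "integral {0..1} (\<lambda>\<sigma>. K (x - c j \<sigma>) *v vector_derivative (c j) (at \<sigma> within {0..1})) $ i =
      integral {0..1} (\<lambda>\<sigma>. Bcontfun (\<lambda>y. K (x - y) $ i) (c j \<sigma>) \<bullet> g j \<sigma>)"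
    if j: "j \<in> {1..N}" for i j
  proof -
    have app: "apply_bcontfun (Bcontfun (\<lambda>y. K (x - y) $ i)) = (\<lambda>y. K (x - y) $ i)" for i
      by (rule Bcontfun_inverse[OF row_bcontfun[OF K]])
    have "continuous_on {0..1} (\<lambda>\<sigma>. \<chi> i. K (x - c j \<sigma>) $ i \<bullet> g j \<sigma>)"
      using continuous_on_test_along_curve[OF c[OF j], of "Bcontfun (\<lambda>y. K (x - y) $ _)"]
      unfolding app by (intro continuous_on_vec_lambda)
    moreover have eq: "(\<chi> i. K (x - c j \<sigma>) $ i \<bullet> g j \<sigma>) = K (x - c j \<sigma>) *v g j \<sigma>" for \<sigma>
      by (simp add: vec_eq_iff matrix_vector_mul_component)
    ultimately have int: "(\<lambda>\<sigma>. K (x - c j \<sigma>) *v g j \<sigma>) integrable_on {0..1}"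
      by (auto intro: integrable_continuous_real)
    have "integral {0..1} (\<lambda>\<sigma>. K (x - c j \<sigma>) *v vector_derivative (c j) (at \<sigma> within {0..1})) =
        integral {0..1} (\<lambda>\<sigma>. K (x - c j \<sigma>) *v g j \<sigma>)"
      by (rule integral_cong) (simp add: curve_deriv_vector_derivative[OF c[OF j]])
    also have "\<dots> $ i = integral {0..1} (\<lambda>\<sigma>. (K (x - c j \<sigma>) *v g j \<sigma>) $ i)"
      by (rule integral_component_eq_cart[OF int, symmetric])
    finally show ?thesis unfolding app by (simp add: matrix_vector_mul_component)
  qed
  moreover have "curve_current \<alpha> N c \<theta> = (\<Sum>j=1..N. \<alpha> j * integral {0..1} (\<lambda>\<sigma>. \<theta> (c j \<sigma>) \<bullet> g j \<sigma>))" for \<theta>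
    by (rule curve_current_eq[OF c])
  ultimately show ?thesis
    by (simp add: conv_def vec_eq_iff)
qed

section \<open>Push-forward of curve currents along a C1 map\<close>

lemma transpose_matrix_inner:
  fixes A :: "(real^'n) \<Rightarrow>\<^sub>L (real^'n)"
  shows "(transpose (matrix (blinfun_apply A)) *v w) \<bullet> u = w \<bullet> A u"
proof -
  have "(transpose (matrix (blinfun_apply A)) *v w) \<bullet> u = w \<bullet> (matrix (blinfun_apply A) *v u)"
    by (simp add: dot_lmul_matrix)
  also have "matrix (blinfun_apply A) *v u = A u"
    using matrix_vector_mul(2)[OF bounded_linear.linear[OF blinfun.bounded_linear_right], of A]
    by metis
  finally show ?thesis .
qed

text \<open>The formula defining \<open>push_test\<close> can be read off only after its right-hand
  side is known to be bounded and continuous; the conditions on \<open>D\<close> supply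
  this.\<close>

lemma push_test_apply:
  fixes \<phi> :: "real^'n \<Rightarrow> real^'n"
  assumes der: "\<And>x. (\<phi> has_derivative blinfun_apply (D x)) (at x)"
    and cD: "continuous_on UNIV D" and bD: "\<And>x. norm (D x) \<le> b"
  shows "apply_bcontfun (push_test \<phi> \<theta>) x = transpose (matrix (blinfun_apply (D x))) *v \<theta> (\<phi> x)"
proof -
  have fd: "frechet_derivative \<phi> (at x) = D x" for x
    using frechet_derivative_at[OF der] by simp
  \<comment> \<open>Written by components, the transposed matrix becomes a pairing with
    \<open>D x (axis i 1)\<close>, whose continuity and bound follow from those of
    \<open>D\<close>.\<close>
  have eq: "transpose (matrix (blinfun_apply (D x))) *v \<theta> (\<phi> x) = (\<chi> i. \<theta> (\<phi> x) \<bullet> D x (axis i 1))" for x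
    using transpose_matrix_inner[of "D x" "\<theta> (\<phi> x)" "axis _ 1"]
    by (simp add: vec_eq_iff inner_axis)
  have c\<phi>: "continuous_on UNIV \<phi>"
    using der by (meson differentiableI differentiable_imp_continuous_on differentiable_on_def differentiable_at_withinI)
  have "(\<lambda>x. transpose (matrix (blinfun_apply (D x))) *v \<theta> (\<phi> x)) \<in> bcontfun"
    unfolding eq
  proof (rule bcontfun_normI)
    show "continuous_on UNIV (\<lambda>x. \<chi> i. \<theta> (\<phi> x) \<bullet> D x (axis i 1))"
      by (intro continuous_intros bounded_linear.continuous_on[OF blinfun.bounded_linear_left cD]
          continuous_on_compose2[of UNIV "apply_bcontfun \<theta>" UNIV \<phi>] c\<phi>) auto
    fix x
    have "norm (\<chi> i. \<theta> (\<phi> x) \<bullet> D x (axis i 1)) \<le> (\<Sum>i\<in>(UNIV::'n set). \<bar>(\<chi> i. \<theta> (\<phi> x) \<bullet> D x (axis i 1)) $ i\<bar>)"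
      by (rule norm_le_l1_cart)
    also have "\<dots> \<le> (\<Sum>i\<in>(UNIV::'n set). norm \<theta> * b)"
    proof (rule sum_mono)
      fix i :: 'n
      have "norm (D x (axis i 1)) \<le> b" using norm_blinfun[of "D x" "axis i 1"] bD[of x] by simp
      then have "norm (\<theta> (\<phi> x)) * norm (D x (axis i 1)) \<le> norm \<theta> * b"
        by (intro mult_mono norm_bounded) auto
      then show "\<bar>(\<chi> i. \<theta> (\<phi> x) \<bullet> D x (axis i 1)) $ i\<bar> \<le> norm \<theta> * b"
        using Cauchy_Schwarz_ineq2[of "\<theta> (\<phi> x)" "D x (axis i 1)"] by simp
    qed
    finally show "norm (\<chi> i. \<theta> (\<phi> x) \<bullet> D x (axis i 1)) \<le> (\<Sum>i\<in>(UNIV::'n set). norm \<theta> * b)" .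
  qed
  then show ?thesis unfolding push_test_def fd by (simp add: Bcontfun_inverse)
qed

lemma curve_deriv_compose:
  fixes \<phi> :: "real^'n \<Rightarrow> real^'n"
  assumes der: "\<And>x. (\<phi> has_derivative blinfun_apply (D x)) (at x)"
    and cD: "continuous_on UNIV D" and c: "curve_deriv c g"
  shows "curve_deriv (\<lambda>\<sigma>. \<phi> (c \<sigma>)) (\<lambda>\<sigma>. D (c \<sigma>) (g \<sigma>))"
  unfolding curve_deriv_def
proof (intro conjI ballI)
  show "continuous_on {0..1} (\<lambda>\<sigma>. D (c \<sigma>) (g \<sigma>))"
    by (intro bounded_bilinear.continuous_on[OF bounded_bilinear_blinfun_apply]
        continuous_on_compose2[OF cD] curve_deriv_continuous[OF c])
      (use c in \<open>auto simp: curve_deriv_def\<close>)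
  fix \<sigma> :: real assume "\<sigma> \<in> {0..1}"
  then have "(c has_derivative (\<lambda>h. h *\<^sub>R g \<sigma>)) (at \<sigma> within {0..1})"
    using c by (auto simp: curve_deriv_def has_vector_derivative_def)
  from has_derivative_compose[OF this der]
  show "((\<lambda>\<sigma>. \<phi> (c \<sigma>)) has_vector_derivative D (c \<sigma>) (g \<sigma>)) (at \<sigma> within {0..1})"
    by (simp add: has_vector_derivative_def blinfun.scaleR_right)
qed

text \<open>The transposed derivative acting on the test function moves across the inner product to
  the tangent, producing \<open>D (c j \<sigma>) (g j \<sigma>)\<close>, the tangent of the
  transported curve.\<close>

lemma push_curve_current:
  fixes \<phi> :: "real^'n \<Rightarrow> real^'n"
  assumes der: "\<And>x. (\<phi> has_derivative blinfun_apply (D x)) (at x)"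
    and cD: "continuous_on UNIV D" and bD: "\<And>x. norm (D x) \<le> b"
    and c: "\<And>j. j \<in> {1..N} \<Longrightarrow> curve_deriv (c j) (g j)"
  shows "push \<phi> (curve_current \<alpha> N c) = curve_current \<alpha> N (\<lambda>j \<sigma>. \<phi> (c j \<sigma>))"
proof
  fix \<theta>
  have "curve_current \<alpha> N (\<lambda>j \<sigma>. \<phi> (c j \<sigma>)) \<theta> =
      (\<Sum>j=1..N. \<alpha> j * integral {0..1} (\<lambda>\<sigma>. \<theta> (\<phi> (c j \<sigma>)) \<bullet> D (c j \<sigma>) (g j \<sigma>)))"
    by (rule curve_current_eq[OF curve_deriv_compose[OF der cD c]])
  also have "\<dots> = curve_current \<alpha> N c (push_test \<phi> \<theta>)"
    using curve_current_eq[of N c g \<alpha> "push_test \<phi> \<theta>", OF c]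
    unfolding push_test_apply[OF der cD bD] transpose_matrix_inner by simp
  finally show "push \<phi> (curve_current \<alpha> N c) \<theta> = curve_current \<alpha> N (\<lambda>j \<sigma>. \<phi> (c j \<sigma>)) \<theta>"
    by (simp add: push_def)
qed

section \<open>Weak continuity in time of the current of a C1 family\<close>

text \<open>\<open>C1_rect\<close> states joint continuity of the partial derivatives, not of
  \<open>\<gamma>\<close>. The time derivative is bounded on the compact rectangle, so
  \<open>\<gamma>\<close> is Lipschitz in time uniformly in the parameter.\<close>

lemma C1_rect_continuous:
  fixes \<gamma> :: "real \<Rightarrow> real \<Rightarrow> real^'n"
  assumes dt: "continuous_on ({0..T} \<times> {0..1}) (\<lambda>p. dt (fst p) (snd p))"
    and t: "\<And>t \<sigma>. t \<in> {0..T} \<Longrightarrow> \<sigma> \<in> {0..1} \<Longrightarrow>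
      ((\<lambda>\<tau>. \<gamma> \<tau> \<sigma>) has_vector_derivative dt t \<sigma>) (at t within {0..T})"
    and \<sigma>: "\<And>t. t \<in> {0..T} \<Longrightarrow> continuous_on {0..1} (\<gamma> t)"
  shows "continuous_on ({0..T} \<times> {0..1}) (\<lambda>p. \<gamma> (fst p) (snd p))"
proof -
  have "compact ({0..T} \<times> {0..1::real})" by (intro compact_Times compact_Icc)
  from compact_imp_bounded[OF compact_continuous_image[OF dt this]]
  obtain m where m: "\<And>t \<sigma>. t \<in> {0..T} \<Longrightarrow> \<sigma> \<in> {0..1} \<Longrightarrow> norm (dt t \<sigma>) \<le> m"
    unfolding bounded_iff by fastforce
  \<comment> \<open>The variables are swapped because the Lipschitz variable, here time, must come
    second.\<close>
  have "continuous_on ({0..1} \<times> {0..T}) (\<lambda>p. \<gamma> (snd p) (fst p))"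
  proof (rule continuous_on_prod_lipschitz_snd[where g = "\<lambda>\<sigma> t. \<gamma> t \<sigma>"])
    fix \<sigma> t u :: real assume *: "\<sigma> \<in> {0..1}" "t \<in> {0..T}" "u \<in> {0..T}"
    show "norm (\<gamma> t \<sigma> - \<gamma> u \<sigma>) \<le> m * norm (t - u)"
    proof (rule differentiable_bound[where S = "{0..T}" and f' = "\<lambda>t h. h *\<^sub>R dt t \<sigma>"])
      fix t assume "t \<in> {0..T}"
      then show "((\<lambda>t. \<gamma> t \<sigma>) has_derivative (\<lambda>h. h *\<^sub>R dt t \<sigma>)) (at t within {0..T})"
        using t * by (simp add: has_vector_derivative_def)
      show "onorm (\<lambda>h. h *\<^sub>R dt t \<sigma>) \<le> m"
      proof (rule onorm_le)
        show "norm (h *\<^sub>R dt t \<sigma>) \<le> m * norm h" for h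
          using mult_right_mono[OF m[OF \<open>t \<in> {0..T}\<close> *(1)], of "norm h"] by (simp add: mult.commute)
      qed
    qed (use * in auto)
  qed (rule \<sigma>)
  moreover have "continuous_on ({0..T} \<times> {0..1::real}) (\<lambda>p. (snd p, fst p))"
    by (intro continuous_intros)
  moreover have "(\<lambda>p. (snd p, fst p)) ` ({0..T} \<times> {0..1}) \<subseteq> {0..1::real} \<times> {0..T}" by auto
  ultimately have "continuous_on ({0..T} \<times> {0..1}) (\<lambda>p. \<gamma> (snd (snd p, fst p)) (fst (snd p, fst p)))"
    by (rule continuous_on_compose2)
  then show ?thesis by simp
qed

lemma continuous_on_slice:
  assumes "continuous_on (A \<times> B) (\<lambda>p. f (fst p) (snd p))" and "t \<in> A"
  shows "continuous_on B (f t)"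
proof -
  have "continuous_on B (\<lambda>\<sigma>. (t, \<sigma>))" by (intro continuous_intros)
  moreover have "(\<lambda>\<sigma>. (t, \<sigma>)) ` B \<subseteq> A \<times> B" using assms(2) by auto
  ultimately show ?thesis
    using continuous_on_compose2[OF assms(1)] by fastforce
qed

lemma C1_rectE:
  assumes "C1_rect T \<gamma>"
  obtains dt ds where
    "continuous_on ({0..T} \<times> {0..1}) (\<lambda>p. \<gamma> (fst p) (snd p))"
    "continuous_on ({0..T} \<times> {0..1}) (\<lambda>p. ds (fst p) (snd p))"
    "\<And>t. t \<in> {0..T} \<Longrightarrow> curve_deriv (\<gamma> t) (ds t)"
    "\<And>t \<sigma>. t \<in> {0..T} \<Longrightarrow> \<sigma> \<in> {0..1} \<Longrightarrow>
       ((\<lambda>\<tau>. \<gamma> \<tau> \<sigma>) has_vector_derivative dt t \<sigma>) (at t within {0..T})"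
proof -
  obtain dt ds where *: "continuous_on ({0..T} \<times> {0..1}) (\<lambda>p. dt (fst p) (snd p))"
    "continuous_on ({0..T} \<times> {0..1}) (\<lambda>p. ds (fst p) (snd p))"
    and d: "\<forall>t\<in>{0..T}. \<forall>\<sigma>\<in>{0..1}.
       ((\<lambda>\<tau>. \<gamma> \<tau> \<sigma>) has_vector_derivative dt t \<sigma>) (at t within {0..T}) \<and>
       ((\<lambda>s. \<gamma> t s) has_vector_derivative ds t \<sigma>) (at \<sigma> within {0..1})"
    using assms unfolding C1_rect_def by (elim exE conjE)
  have t: "((\<lambda>\<tau>. \<gamma> \<tau> \<sigma>) has_vector_derivative dt t \<sigma>) (at t within {0..T})"
    and s: "(\<gamma> t has_vector_derivative ds t \<sigma>) (at \<sigma> within {0..1})"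
    if "t \<in> {0..T}" "\<sigma> \<in> {0..1}" for t \<sigma>
    using d that by blast+
  have cd: "curve_deriv (\<gamma> t) (ds t)" if "t \<in> {0..T}" for t
    unfolding curve_deriv_def
    using s[OF that] continuous_on_slice[OF *(2) that] by blast
  show ?thesis
    using that[OF C1_rect_continuous[OF *(1) t] *(2) cd t] curve_deriv_continuous[OF cd] by blast
qed

text \<open>The weak metric is essential: currents on nearby but distinct curves can be far apart in
  the dual of \<open>C_b\<close>, whereas a Lipschitz test function changes little between nearby
  points.\<close>

lemma cont_Mw_curve_current:
  fixes \<gamma> :: "nat \<Rightarrow> real \<Rightarrow> real \<Rightarrow> real^'n"
  assumes "\<And>i. i \<in> {1..N} \<Longrightarrow> C1_rect T (\<gamma> i)"
  shows "cont_Mw T (\<lambda>t. curve_current \<alpha> N (\<lambda>j. \<gamma> j t))"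
proof -
  have "\<exists>g. continuous_on ({0..T} \<times> {0..1}) (\<lambda>p. \<gamma> i (fst p) (snd p)) \<and>
    continuous_on ({0..T} \<times> {0..1}) (\<lambda>p. g (fst p) (snd p)) \<and>
    (\<forall>t\<in>{0..T}. curve_deriv (\<gamma> i t) (g t))" if "i \<in> {1..N}" for i
    using C1_rectE[OF assms[OF that]] by metis
  then have "\<forall>i\<in>{1..N}. \<exists>g. continuous_on ({0..T} \<times> {0..1}) (\<lambda>p. \<gamma> i (fst p) (snd p)) \<and>
    continuous_on ({0..T} \<times> {0..1}) (\<lambda>p. g (fst p) (snd p)) \<and>
    (\<forall>t\<in>{0..T}. curve_deriv (\<gamma> i t) (g t))" by blast
  from bchoice[OF this] obtain g where
    c\<gamma>: "\<And>i. i \<in> {1..N} \<Longrightarrow> continuous_on ({0..T} \<times> {0..1}) (\<lambda>p. \<gamma> i (fst p) (snd p))" and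
    cg: "\<And>i. i \<in> {1..N} \<Longrightarrow> continuous_on ({0..T} \<times> {0..1}) (\<lambda>p. g i (fst p) (snd p))" and
    cd: "\<And>i t. i \<in> {1..N} \<Longrightarrow> t \<in> {0..T} \<Longrightarrow> curve_deriv (\<gamma> i t) (g i t)"
    by blast
  have cur: "is_current (curve_current \<alpha> N (\<lambda>j. \<gamma> j t))" if "t \<in> {0..T}" for t
    by (rule is_current_curve_current[OF cd[OF _ that]])
  have "((\<lambda>s. dist_w (curve_current \<alpha> N (\<lambda>j. \<gamma> j s)) (curve_current \<alpha> N (\<lambda>j. \<gamma> j t))) \<longlongrightarrow> 0) (at t within {0..T})"
    if t: "t \<in> {0..T}" for t
  proof -
    \<comment> \<open>Majorant of the difference of integrands, the same for all admissible
      \<open>\<theta>\<close>: Lipschitz constant at most 1 handles the moved point, sup norm at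
      most 1 the changed tangent.\<close>
    define f where "f = (\<lambda>j s \<sigma>. norm (\<gamma> j s \<sigma> - \<gamma> j t \<sigma>) * norm (g j t \<sigma>) + norm (g j s \<sigma> - g j t \<sigma>))"
    define \<rho> where "\<rho> = (\<lambda>s. \<Sum>j=1..N. \<bar>\<alpha> j\<bar> * integral {0..1} (f j s))"
    have cf: "continuous_on ({0..T} \<times> {0..1}) (\<lambda>p. f j (fst p) (snd p))" if j: "j \<in> {1..N}" for j
    proof -
      have "continuous_on ({0..T} \<times> {0..1}) (\<lambda>p. \<gamma> j t (snd p))"
        by (rule continuous_on_compose2[OF continuous_on_slice[OF c\<gamma>[OF j] t]])
          (auto intro!: continuous_intros)
      moreover have "continuous_on ({0..T} \<times> {0..1}) (\<lambda>p. g j t (snd p))"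
        by (rule continuous_on_compose2[OF continuous_on_slice[OF cg[OF j] t]])
          (auto intro!: continuous_intros)
      ultimately show ?thesis
        unfolding f_def by (intro continuous_intros c\<gamma>[OF j] cg[OF j])
    qed
    have cf1: "continuous_on {0..1} (f j s)" if "j \<in> {1..N}" "s \<in> {0..T}" for j s
      by (rule continuous_on_slice[OF cf[OF that(1)] that(2)])
    have c\<rho>: "continuous_on {0..T} \<rho>"
      unfolding \<rho>_def
    proof (intro continuous_intros)
      fix j assume "j \<in> {1..N}"
      from integral_continuous_on_param[of "{0..T}" 0 1 "f j"] cf[OF this]
      show "continuous_on {0..T} (\<lambda>s. integral {0..1} (f j s))" by (simp add: split_def)
    qed
    have "\<rho> t = 0" by (simp add: \<rho>_def f_def)
    then have lim: "(\<rho> \<longlongrightarrow> 0) (at t within {0..T})"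
      using c\<rho> t unfolding continuous_on_def by metis
    have bnd: "dist_w (curve_current \<alpha> N (\<lambda>j. \<gamma> j s)) (curve_current \<alpha> N (\<lambda>j. \<gamma> j t)) \<le> \<rho> s"
      if s: "s \<in> {0..T}" for s
    proof (rule dist_w_least)
      fix \<theta> :: "(real^'n) \<Rightarrow>\<^sub>C (real^'n)" and L
      assume lip: "L-lipschitz_on UNIV (apply_bcontfun \<theta>)" and n: "norm \<theta> + L \<le> 1"
      have L: "0 \<le> L" "L \<le> 1" "norm \<theta> \<le> 1"
        using lipschitz_on_nonneg[OF lip] n norm_ge_zero[of \<theta>] by linarith+
      let ?I = "\<lambda>j s. integral {0..1} (\<lambda>\<sigma>. \<theta> (\<gamma> j s \<sigma>) \<bullet> g j s \<sigma>)"
      have eq: "curve_current \<alpha> N (\<lambda>j. \<gamma> j u) \<theta> = (\<Sum>j=1..N. \<alpha> j * ?I j u)" if "u \<in> {0..T}" for u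
        by (rule curve_current_eq[OF cd[OF _ that]])
      have "\<alpha> j * ?I j s - \<alpha> j * ?I j t \<le> \<bar>\<alpha> j\<bar> * integral {0..1} (f j s)" if j: "j \<in> {1..N}" for j
      proof -
        have int: "(\<lambda>\<sigma>. \<theta> (\<gamma> j s \<sigma>) \<bullet> g j s \<sigma>) integrable_on {0..1}" if "s \<in> {0..T}" for s
          by (intro integrable_continuous_real continuous_on_test_along_curve cd j that)
        have "norm (?I j s - ?I j t) \<le> integral {0..1} (f j s)"
          unfolding Henstock_Kurzweil_Integration.integral_diff[OF int[OF s] int[OF t], symmetric]
        proof (rule Henstock_Kurzweil_Integration.integral_norm_bound_integral)
          show "(\<lambda>\<sigma>. \<theta> (\<gamma> j s \<sigma>) \<bullet> g j s \<sigma> - \<theta> (\<gamma> j t \<sigma>) \<bullet> g j t \<sigma>) integrable_on {0..1}"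
            by (intro Henstock_Kurzweil_Integration.integrable_diff int s t)
          show "f j s integrable_on {0..1}"
            by (intro integrable_continuous_real cf1 j s)
          fix \<sigma>
          have "norm (\<theta> (\<gamma> j s \<sigma>) - \<theta> (\<gamma> j t \<sigma>)) \<le> L * norm (\<gamma> j s \<sigma> - \<gamma> j t \<sigma>)"
            using lipschitz_onD[OF lip, of "\<gamma> j s \<sigma>" "\<gamma> j t \<sigma>"] by (simp add: dist_norm)
          also have "\<dots> \<le> 1 * norm (\<gamma> j s \<sigma> - \<gamma> j t \<sigma>)" using L by (intro mult_right_mono) auto
          finally have 0: "norm (\<theta> (\<gamma> j s \<sigma>) - \<theta> (\<gamma> j t \<sigma>)) \<le> norm (\<gamma> j s \<sigma> - \<gamma> j t \<sigma>)" by simp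
          have 1: "norm ((\<theta> (\<gamma> j s \<sigma>) - \<theta> (\<gamma> j t \<sigma>)) \<bullet> g j t \<sigma>) \<le> norm (\<gamma> j s \<sigma> - \<gamma> j t \<sigma>) * norm (g j t \<sigma>)"
            by (rule order_trans[OF _ mult_right_mono[OF 0 norm_ge_zero]]) (simp add: Cauchy_Schwarz_ineq2)
          have "norm (\<theta> (\<gamma> j s \<sigma>)) \<le> 1" using norm_bounded[of \<theta> "\<gamma> j s \<sigma>"] L by linarith
          then have 2: "norm (\<theta> (\<gamma> j s \<sigma>) \<bullet> (g j s \<sigma> - g j t \<sigma>)) \<le> norm (g j s \<sigma> - g j t \<sigma>)"
            using Cauchy_Schwarz_ineq2[of "\<theta> (\<gamma> j s \<sigma>)" "g j s \<sigma> - g j t \<sigma>"]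
              mult_right_mono[of "norm (\<theta> (\<gamma> j s \<sigma>))" 1 "norm (g j s \<sigma> - g j t \<sigma>)"] by simp
          have "\<theta> (\<gamma> j s \<sigma>) \<bullet> g j s \<sigma> - \<theta> (\<gamma> j t \<sigma>) \<bullet> g j t \<sigma> =
              (\<theta> (\<gamma> j s \<sigma>) - \<theta> (\<gamma> j t \<sigma>)) \<bullet> g j t \<sigma> + \<theta> (\<gamma> j s \<sigma>) \<bullet> (g j s \<sigma> - g j t \<sigma>)"
            by (simp add: inner_diff_left inner_diff_right)
          then show "norm (\<theta> (\<gamma> j s \<sigma>) \<bullet> g j s \<sigma> - \<theta> (\<gamma> j t \<sigma>) \<bullet> g j t \<sigma>) \<le> f j s \<sigma>"
            using norm_triangle_mono[OF 1 2] unfolding f_def by simp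
        qed
        then have "\<bar>\<alpha> j\<bar> * \<bar>?I j s - ?I j t\<bar> \<le> \<bar>\<alpha> j\<bar> * integral {0..1} (f j s)"
          by (intro mult_left_mono) auto
        then show ?thesis
          using abs_ge_self[of "\<alpha> j * (?I j s - ?I j t)"]
          unfolding right_diff_distrib[symmetric] abs_mult by linarith
      qed
      then show "curve_current \<alpha> N (\<lambda>j. \<gamma> j s) \<theta> - curve_current \<alpha> N (\<lambda>j. \<gamma> j t) \<theta> \<le> \<rho> s"
        unfolding eq[OF s] eq[OF t] \<rho>_def sum_subtractf[symmetric] by (rule sum_mono)
    qed
    show ?thesis
      by (rule Lim_null_comparison[OF _ lim])
        (use bnd dist_w_nonneg[OF cur cur[OF t]] in
          \<open>auto simp: eventually_at_filter intro!: always_eventually\<close>)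
  qed
  with cur show ?thesis by (simp add: cont_Mw_def)
qed

section \<open>From the interaction equation to the flow equation and back\<close>

text \<open>The conclusions are ordered to discharge the hypotheses on \<open>\<phi>\<close> and
  \<open>D\<close> in \<open>push_curve_current\<close>.\<close>

lemma flow_C1:
  assumes "smooth_field (v :: real \<Rightarrow> real^'n \<Rightarrow> real^'n) v' T L M" and t: "t \<in> {0..T}"
  shows "(flow v t has_derivative blinfun_apply (smooth_field.dsol v v' T x t)) (at x)"
    and "continuous_on UNIV (\<lambda>x. smooth_field.dsol v v' T x t)"
    and "norm (smooth_field.dsol v v' T x t) \<le> exp (L * T)"
proof -
  interpret smooth_field v v' T L M by fact
  have "flow v t = (\<lambda>x. sol x t)" using flow_eq_sol[OF assms] by blast
  then show "(flow v t has_derivative blinfun_apply (dsol x t)) (at x)"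
    using sol_has_derivative[OF t] by simp
  show "continuous_on UNIV (\<lambda>x. dsol x t)"
    by (rule continuous_on_dsol_prod) (use t in \<open>auto intro!: continuous_intros\<close>)
  show "norm (dsol x t) \<le> exp (L * T)" by (rule norm_dsol_le[OF t])
qed

lemma UCb3_bounded_continuous:
  assumes "UCb3 K"
  obtains a where "continuous_on UNIV K" "\<And>z. norm (K z) \<le> a"
  using assms uniformly_continuous_imp_continuous unfolding UCb3_def bounded_iff by blast

text \<open>Once the curves are given, \<open>v\<close> is a known time-dependent field, and each
  \<open>\<gamma> i\<close> at fixed \<open>\<sigma>\<close> is one of its trajectories; the flow
  therefore carries the initial curves to those at time \<open>t\<close>.\<close>

lemma interacting_curves_imp_flow_eq:
  fixes K :: "real^'n \<Rightarrow> real^'n^'n" and \<gamma> :: "nat \<Rightarrow> real \<Rightarrow> real \<Rightarrow> real^'n"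
  assumes K: "UCb3 K" and T: "0 < T"
    and C1: "\<And>i. i \<in> {1..N} \<Longrightarrow> C1_rect T (\<gamma> i)"
    and E1: "interacting_curves K \<alpha> N T \<gamma>"
  shows "flow_eq K T (\<lambda>t. curve_current \<alpha> N (\<lambda>j. \<gamma> j t))"
  unfolding flow_eq_def
proof
  fix t assume t: "t \<in> {0..T}"
  define \<xi> where "\<xi> = (\<lambda>t. curve_current \<alpha> N (\<lambda>j. \<gamma> j t))"
  define v where "v = (\<lambda>s. conv K (\<xi> s))"
  have "cont_Mw T \<xi>" unfolding \<xi>_def by (rule cont_Mw_curve_current[OF C1])
  then obtain v' L M where sf: "smooth_field v v' T L M"
    unfolding v_def using smooth_field_conv[OF K] T less_imp_le by metis
  interpret smooth_field v v' T L M by fact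
  obtain a where Ka: "continuous_on UNIV K" "\<And>z. norm (K z) \<le> a"
    using UCb3_bounded_continuous[OF K] by blast
  have "\<exists>g. \<forall>t\<in>{0..T}. curve_deriv (\<gamma> i t) (g t)" if "i \<in> {1..N}" for i
    using C1_rectE[OF C1[OF that]] by metis
  then obtain g where cd: "\<And>i t. i \<in> {1..N} \<Longrightarrow> t \<in> {0..T} \<Longrightarrow> curve_deriv (\<gamma> i t) (g i t)"
    by metis
  have cd0: "curve_deriv (\<gamma> i 0) (g i 0)" if "i \<in> {1..N}" for i using cd[OF that] T by simp
  have ode: "((\<lambda>\<tau>. \<gamma> i \<tau> \<sigma>) has_vector_derivative v s (\<gamma> i s \<sigma>)) (at s within {0..T})"
    if i: "i \<in> {1..N}" and s: "s \<in> {0..T}" and \<sigma>: "\<sigma> \<in> {0..1}" for i s \<sigma>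
  proof -
    obtain d where d: "((\<lambda>\<tau>. \<gamma> i \<tau> \<sigma>) has_vector_derivative d) (at s within {0..T})"
      using C1_rectE[OF C1[OF i]] s \<sigma> by metis
    \<comment> \<open>The derivative within \<open>[0,T]\<close> is unique since
      \<open>0 < T\<close>; this lets the interaction equation be read as an ODE.\<close>
    then have "d = vector_derivative (\<lambda>\<tau>. \<gamma> i \<tau> \<sigma>) (at s within {0..T})"
      using vector_derivative_within_cbox[of 0 T s "\<lambda>\<tau>. \<gamma> i \<tau> \<sigma>" d] T s by simp
    also have "\<dots> = (\<Sum>j=1..N. \<alpha> j *\<^sub>R integral {0..1}
        (\<lambda>\<sigma>'. K (\<gamma> i s \<sigma> - \<gamma> j s \<sigma>') *v vector_derivative (\<gamma> j s) (at \<sigma>' within {0..1})))"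
      using E1 i s \<sigma> unfolding interacting_curves_def by blast
    also have "\<dots> = v s (\<gamma> i s \<sigma>)"
      unfolding v_def \<xi>_def by (rule conv_curve_current[OF Ka cd[OF _ s], symmetric])
    finally show ?thesis using d by simp
  qed
  have flow: "flow v t (\<gamma> i 0 \<sigma>) = \<gamma> i t \<sigma>" if "i \<in> {1..N}" "\<sigma> \<in> {0..1}" for i \<sigma>
  proof -
    have "\<gamma> i t \<sigma> = sol (\<gamma> i 0 \<sigma>) t"
      using t that
      by (intro sol_unique[where y = "\<lambda>\<tau>. \<gamma> i \<tau> \<sigma>"] has_vector_derivative_within_subset[OF ode]) auto
    then show ?thesis using flow_eq_sol[OF sf t] by simp
  qed
  have "push (flow v t) (\<xi> 0) = curve_current \<alpha> N (\<lambda>j \<sigma>. flow v t (\<gamma> j 0 \<sigma>))"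
    unfolding \<xi>_def by (rule push_curve_current[OF flow_C1[OF sf t] cd0])
  also have "\<dots> = curve_current \<alpha> N (\<lambda>j. \<gamma> j t)"
    by (rule curve_current_cong[symmetric, OF cd[OF _ t]]) (use flow in auto)
  finally show "curve_current \<alpha> N (\<lambda>j. \<gamma> j t) =
      push (flow (\<lambda>s. conv K (curve_current \<alpha> N (\<lambda>j. \<gamma> j s))) t) (curve_current \<alpha> N (\<lambda>j. \<gamma> j 0))"
    by (simp add: v_def \<xi>_def)
qed

text \<open>The representation of \<open>\<xi> t\<close> has to come first: only through it does the
  field \<open>conv K (\<xi> t)\<close>, built from an abstract current, become a sum of integrals
  over the transported curves.\<close>

lemma flow_eq_imp_interacting_curves:
  fixes K :: "real^'n \<Rightarrow> real^'n^'n" and \<gamma>0 :: "nat \<Rightarrow> real \<Rightarrow> real^'n" and \<xi> :: "real \<Rightarrow> 'n current"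
  defines "\<gamma> \<equiv> (\<lambda>i t \<sigma>. flow (\<lambda>s. conv K (\<xi> s)) t (\<gamma>0 i \<sigma>))"
  assumes K: "UCb3 K" and T: "0 < T"
    and C1: "\<And>i. i \<in> {1..N} \<Longrightarrow> C1_curve (\<gamma>0 i)"
    and cont: "cont_Mw T \<xi>" and fe: "flow_eq K T \<xi>" and \<xi>0: "\<xi> 0 = curve_current \<alpha> N \<gamma>0"
  shows "\<And>t. t \<in> {0..T} \<Longrightarrow> \<xi> t = curve_current \<alpha> N (\<lambda>j. \<gamma> j t)"
    and "\<And>i. i \<in> {1..N} \<Longrightarrow> C1_rect T (\<gamma> i)"
    and "interacting_curves K \<alpha> N T \<gamma>"
proof -
  define v where "v = (\<lambda>s. conv K (\<xi> s))"
  obtain v' L M where sf: "smooth_field v v' T L M"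
    unfolding v_def using smooth_field_conv[OF K cont] T less_imp_le by metis
  interpret smooth_field v v' T L M by fact
  obtain a where Ka: "continuous_on UNIV K" "\<And>z. norm (K z) \<le> a"
    using UCb3_bounded_continuous[OF K] by blast
  obtain g where cd0: "\<And>i. i \<in> {1..N} \<Longrightarrow> curve_deriv (\<gamma>0 i) (g i)"
    using C1 unfolding C1_curve_def curve_deriv_def by metis
  have \<gamma>: "\<gamma> i t \<sigma> = sol (\<gamma>0 i \<sigma>) t" if "t \<in> {0..T}" for i t \<sigma>
    unfolding \<gamma>_def using flow_eq_sol[OF sf that] by (simp add: v_def)
  show rep: "\<xi> t = curve_current \<alpha> N (\<lambda>j. \<gamma> j t)" if t: "t \<in> {0..T}" for t
  proof -
    have "\<xi> t = push (flow v t) (\<xi> 0)" using fe t unfolding flow_eq_def v_def by blast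
    also have "\<dots> = curve_current \<alpha> N (\<lambda>j \<sigma>. flow v t (\<gamma>0 j \<sigma>))"
      unfolding \<xi>0 by (rule push_curve_current[OF flow_C1[OF sf t] cd0])
    finally show ?thesis by (simp add: \<gamma>_def v_def)
  qed
  have cd: "curve_deriv (\<gamma> i t) (\<lambda>\<sigma>. dsol (\<gamma>0 i \<sigma>) t (g i \<sigma>))" if "i \<in> {1..N}" and t: "t \<in> {0..T}" for i t
    using curve_deriv_compose[OF flow_C1(1,2)[OF sf t] cd0[OF that(1)]] by (simp add: \<gamma>_def v_def)
  \<comment> \<open>\<open>flow\<close> refers to a different interval at each
    \<open>\<tau>\<close>; agreement on \<open>[0,T]\<close> with the single trajectory
    \<open>sol (\<gamma>0 i \<sigma>)\<close> makes it differentiable in time.\<close>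
  have dt: "((\<lambda>\<tau>. \<gamma> i \<tau> \<sigma>) has_vector_derivative v t (\<gamma> i t \<sigma>)) (at t within {0..T})"
    if t: "t \<in> {0..T}" for i t \<sigma>
    by (rule has_vector_derivative_transform[OF t, where f = "sol (\<gamma>0 i \<sigma>)"])
      (use \<gamma> sol(2) t in auto)
  show "C1_rect T (\<gamma> i)" if i: "i \<in> {1..N}" for i
    unfolding C1_rect_def
  \<comment> \<open>The partial derivatives are the field along the trajectory, and the linearised
    flow applied to the initial tangent.\<close>
  proof (rule exI[of _ "\<lambda>t \<sigma>. v t (sol (\<gamma>0 i \<sigma>) t)"], rule exI[of _ "\<lambda>t \<sigma>. dsol (\<gamma>0 i \<sigma>) t (g i \<sigma>)"],
      intro conjI ballI)
    have c0: "continuous_on ({0..T} \<times> {0..1}) (\<lambda>p. \<gamma>0 i (snd p))"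
      "continuous_on ({0..T} \<times> {0..1}) (\<lambda>p. g i (snd p))"
      using cd0[OF i] curve_deriv_continuous[OF cd0[OF i]] unfolding curve_deriv_def
      by (auto intro!: continuous_on_compose2[of "{0..1}" _ "{0..T} \<times> {0..1}" snd] continuous_intros)
    show "continuous_on ({0..T} \<times> {0..1}) (\<lambda>p. v (fst p) (sol (\<gamma>0 i (snd p)) (fst p)))"
      by (intro continuous_on_v continuous_on_sol_prod c0) (auto intro!: continuous_intros)
    show "continuous_on ({0..T} \<times> {0..1}) (\<lambda>p. dsol (\<gamma>0 i (snd p)) (fst p) (g i (snd p)))"
      by (intro bounded_bilinear.continuous_on[OF bounded_bilinear_blinfun_apply]
          continuous_on_dsol_prod c0) (auto intro!: continuous_intros)
    fix t \<sigma> :: real assume t: "t \<in> {0..T}" and \<sigma>: "\<sigma> \<in> {0..1}"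
    show "((\<lambda>\<tau>. \<gamma> i \<tau> \<sigma>) has_vector_derivative v t (sol (\<gamma>0 i \<sigma>) t)) (at t within {0..T})"
      using dt[OF t] \<gamma>[OF t] by simp
    show "(\<gamma> i t has_vector_derivative dsol (\<gamma>0 i \<sigma>) t (g i \<sigma>)) (at \<sigma> within {0..1})"
      using cd[OF i t] \<sigma> by (simp add: curve_deriv_def)
  qed
  show "interacting_curves K \<alpha> N T \<gamma>"
    unfolding interacting_curves_def
  proof (intro ballI)
    fix j and t \<sigma> :: real assume t: "t \<in> {0..T}"
    have "vector_derivative (\<lambda>\<tau>. \<gamma> j \<tau> \<sigma>) (at t within {0..T}) = v t (\<gamma> j t \<sigma>)"
      using vector_derivative_within_cbox[of 0 T t "\<lambda>\<tau>. \<gamma> j \<tau> \<sigma>" "v t (\<gamma> j t \<sigma>)"] dt[OF t] T t by simp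
    also have "\<dots> =
       (\<Sum>k=1..N. \<alpha> k *\<^sub>R integral {0..1}
          (\<lambda>\<sigma>'. K (\<gamma> j t \<sigma> - \<gamma> k t \<sigma>') *v vector_derivative (\<gamma> k t) (at \<sigma>' within {0..1})))"
      \<comment> \<open>Rewriting with \<open>rep\<close> replaces \<open>\<xi> t\<close> inside the
        field by the current of the transported curves.\<close>
      unfolding v_def rep[OF t] by (rule conv_curve_current[OF Ka cd[OF _ t]])
    finally show "vector_derivative (\<lambda>\<tau>. \<gamma> j \<tau> \<sigma>) (at t within {0..T}) =
       (\<Sum>k=1..N. \<alpha> k *\<^sub>R integral {0..1}
          (\<lambda>\<sigma>'. K (\<gamma> j t \<sigma> - \<gamma> k t \<sigma>') *v vector_derivative (\<gamma> k t) (at \<sigma>' within {0..1})))" .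
  qed
qed

theorem theorem6p1:
  fixes K :: "real^'n \<Rightarrow> real^'n^'n" and \<alpha> :: "nat \<Rightarrow> real" and N :: nat and T :: real
  assumes "UCb3 K" and "0 < T"
  shows "(\<forall>\<gamma> :: nat \<Rightarrow> real \<Rightarrow> real \<Rightarrow> real^'n.
            (\<forall>i\<in>{1..N}. C1_rect T (\<gamma> i)) \<and> interacting_curves K \<alpha> N T \<gamma> \<longrightarrow>
            flow_eq K T (\<lambda>t. curve_current \<alpha> N (\<lambda>j. \<gamma> j t)))
       \<and> (\<forall>(\<gamma>0 :: nat \<Rightarrow> real \<Rightarrow> real^'n) (\<xi> :: real \<Rightarrow> 'n current).
            (\<forall>i\<in>{1..N}. C1_curve (\<gamma>0 i)) \<and> cont_Mw T \<xi> \<and> flow_eq K T \<xi> \<and>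
            \<xi> 0 = curve_current \<alpha> N \<gamma>0 \<and>
            (\<forall>\<xi>'. cont_Mw T \<xi>' \<and> flow_eq K T \<xi>' \<and> \<xi>' 0 = \<xi> 0 \<longrightarrow> (\<forall>t\<in>{0..T}. \<xi>' t = \<xi> t))
            \<longrightarrow>
            (let \<gamma> = (\<lambda>i t \<sigma>. flow (\<lambda>s. conv K (\<xi> s)) t (\<gamma>0 i \<sigma>)) in
               (\<forall>t\<in>{0..T}. \<xi> t = curve_current \<alpha> N (\<lambda>j. \<gamma> j t)) \<and>
               (\<forall>i\<in>{1..N}. C1_rect T (\<gamma> i)) \<and>
               interacting_curves K \<alpha> N T \<gamma>))"
  unfolding Let_def
  by (intro conjI allI impI ballI; (elim conjE)?)
    (blast intro: interacting_curves_imp_flow_eq[OF assms] flow_eq_imp_interacting_curves[OF assms])+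

end
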